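(* Every P$'$-graph is a P$'''$-graph.
   Context: A graph is given by two functions $W,E\colon A\to V$ ($A$ the edges, $V$ the vertices, assumed disjoint); an edge $a$ goes from $W(a)$ to $E(a)$. For $X\in\{W,E\}$ let $\bar W=E$, $\bar E=W$. A vertex $v$ is an $X$-vertex if there is no edge $a$ with $\bar X(a)=v$; a vertex that is neither a $W$-vertex nor an $E$-vertex is inner. An edge $a$ is an $X$-edge if $X(a)$ is an $X$-vertex, and inner if it is neither a $W$-edge nor an $E$-edge. A semipath is a sequence $v_0a_1v_1\ldots a_nv_n$ ($n\ge 0$) where each $a_i$ joins $v_{i-1}$ and $v_i$ in either direction and no vertex occurs twice; a walk/path is the same with all edges going from $v_{i-1}$ to $v_i$. A D-graph is a finite graph that is acyclic (no directed cycles), $W$-$E$-functional (for every $X$-edge $a$, no other edge $b$ has $X(b)=X(a)$), weakly connected (any two vertices are joined by a semipath), and has at least one inner vertex; a basic D-graph is one with exactly one inner vertex. $X(D)$ denotes the set of $X$-vertices of $D$. Juncture: for D-graphs $D_W$ ($W_W,E_W\colon A_W\to V_W$) and $D_E$ ($W_E,E_E\colon A_E\to V_E$), suppose $C=A_W\cap A_E\neq\emptyset$, for every $a\in C$ we have $E_W(a)=W_E(a)$, $a$ is an $E$-edge of $D_W$ and a $W$-edge of $D_E$, and $V_W\cap V_E=V_C=\{E_W(a)\mid a\in C\}$. Then $D_W\Box D_E$ has edges $A_W\cup A_E$, vertices $(V_W\cup V_E)-V_C$, $W(a)=W_W(a)$ for $a\in A_W$ and $W(a)=W_E(a)$ for $a\in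 A_E-C$, $E(a)=E_E(a)$ for $a\in A_E$ and $E(a)=E_W(a)$ for $a\in A_W-C$. A list is a finite sequence of distinct elements. Two non-empty lists are compatible when they are of the forms $\Phi\Xi$ and $\Xi\Psi$, or $\Phi\Xi\Psi$ and $\Xi$, with $\Phi,\Xi,\Psi$ mutually disjoint and $\Xi$ non-empty. A construction (of a P$'$-graph) is a finite binary tree with a triple $(D,L_W,L_E)$ in each node, $D$ a D-graph and $L_X$ a list of all of $X(D)$: (1) a single node with a basic D-graph and arbitrary such lists is a construction; (2) if $K_W,K_E$ are constructions with roots $(D_W,L^W_W,L^W_E)$ and $(D_E,L^E_W,L^E_E)$ where $L^W_E=\Phi_E\Xi\Psi_E$ and $L^E_W=\Phi_W\Xi\Psi_W$ are compatible, then adding a new root $(D_W\Box D_E,\;\Phi_WL^W_W\Psi_W,\;\Phi_EL^E_E\Psi_E)$ with children the roots of $K_W,K_E$ gives a construction. A P$'$-graph is the D-graph at the root of some construction. For vertices $u,v$ of a D-graph, $[u,v]$ is the set of semipaths from $u$ to $v$, and $[u]_X$ is the set of semipaths from $u$ to some $X$-vertex. For distinct $X$-vertices $u,v,w$, $\psi_X(v,u,w)$ means every semipath in $[v,w]$ shares a vertex with every semipath in $[u]_{\bar X}$. A list $\Lambda$ of $X(D)$ is grounded in $D$ if whenever $v,u,w$ occur in $\Lambda$ in the order $v,u,w$ (or $w,u,v$), not necessarily adjacently, we have $\psi_X(v,u,w)$. D-graphs $D_W,D_E$ with $D_W\Box D_E$ defined are P-compatible when some list of $E(D_W)$ grounded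 in $D_W$ and some list of $W(D_E)$ grounded in $D_E$ are compatible. A cocycle of a D-graph $D$ is a non-empty set $C$ of inner edges whose removal leaves exactly two components $D_1,D_2$, with every edge of $C$ going from a vertex of $D_1$ to a vertex of $D_2$. Cutting $D$ through $C$ gives $D_W$ (from $D_1$ by adding the edges of $C$, each $a\in C$ keeping its $W(a)$ and getting a new vertex $v_a$ as $E(a)$) and $D_E$ (from $D_2$ by adding the edges of $C$ with $E(a)$ as in $D$ and $W(a)=v_a$); then $D=D_W\Box D_E$. A P$'''$-graph is a D-graph $D$ such that for every cocycle $C$ of $D$ the two D-graphs obtained by cutting $D$ through $C$ are P-compatible. *)

theory Defs
  imports "Graph_Theory.Digraph_Component" "Graph_Theory.Arc_Walk"
begin

text \<open>
  Graphs are the records \<^typ>\<open>('v, 'e) pre_digraph\<close>, with \<^const>\<open>tail\<close> in the role of the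
  function W and \<^const>\<open>head\<close> in the role of E; parallel edges are allowed. Vertices and edges
  are disjoint by typing. In all names below, the side \<open>West\<close> stands for W and \<open>East\<close> for E.
\<close>

datatype side = West | East

fun opp :: "side \<Rightarrow> side" where
  "opp West = East"
| "opp East = West"

fun endpoint :: "side \<Rightarrow> ('v, 'e) pre_digraph \<Rightarrow> 'e \<Rightarrow> 'v" where
  "endpoint West D a = tail D a"
| "endpoint East D a = head D a"

definition side_verts :: "side \<Rightarrow> ('v, 'e) pre_digraph \<Rightarrow> 'v set" where
  "side_verts X D = {v \<in> verts D. \<not> (\<exists>a \<in> arcs D. endpoint (opp X) D a = v)}"

definition inner_verts :: "('v, 'e) pre_digraph \<Rightarrow> 'v set" where
  "inner_verts D = verts D - side_verts West D - side_verts East D"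

definition side_edges :: "side \<Rightarrow> ('v, 'e) pre_digraph \<Rightarrow> 'e set" where
  "side_edges X D = {a \<in> arcs D. endpoint X D a \<in> side_verts X D}"

definition inner_edges :: "('v, 'e) pre_digraph \<Rightarrow> 'e set" where
  "inner_edges D = arcs D - side_edges West D - side_edges East D"

text \<open>
  A semipath \<open>v\<^sub>0 a\<^sub>1 v\<^sub>1 \<dots> a\<^sub>n v\<^sub>n\<close> is split into its list of vertices (of length n + 1) and its
  list of edges (of length n).
\<close>

definition joins :: "('v, 'e) pre_digraph \<Rightarrow> 'e \<Rightarrow> 'v \<Rightarrow> 'v \<Rightarrow> bool" where
  "joins D a u v \<longleftrightarrow> a \<in> arcs D \<and>
     (tail D a = u \<and> head D a = v \<or> tail D a = v \<and> head D a = u)"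

definition semipath :: "('v, 'e) pre_digraph \<Rightarrow> 'v list \<Rightarrow> 'e list \<Rightarrow> bool" where
  "semipath D vs es \<longleftrightarrow> length vs = Suc (length es) \<and> set vs \<subseteq> verts D \<and> distinct vs \<and>
     (\<forall>i < length es. joins D (es ! i) (vs ! i) (vs ! Suc i))"

definition semipaths :: "('v, 'e) pre_digraph \<Rightarrow> 'v \<Rightarrow> 'v \<Rightarrow> ('v list \<times> 'e list) set" where
  "semipaths D u v = {(vs, es). semipath D vs es \<and> hd vs = u \<and> last vs = v}"

definition semipaths_to_side ::
    "side \<Rightarrow> ('v, 'e) pre_digraph \<Rightarrow> 'v \<Rightarrow> ('v list \<times> 'e list) set" where
  "semipaths_to_side X D u = (\<Union>v \<in> side_verts X D. semipaths D u v)"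

definition weakly_connected :: "('v, 'e) pre_digraph \<Rightarrow> bool" where
  "weakly_connected D \<longleftrightarrow> (\<forall>u \<in> verts D. \<forall>v \<in> verts D. semipaths D u v \<noteq> {})"

definition WE_functional :: "('v, 'e) pre_digraph \<Rightarrow> bool" where
  "WE_functional D \<longleftrightarrow>
     (\<forall>X. \<forall>a \<in> side_edges X D. \<forall>b \<in> arcs D. endpoint X D b = endpoint X D a \<longrightarrow> b = a)"

definition D_graph :: "('v, 'e) pre_digraph \<Rightarrow> bool" where
  "D_graph D \<longleftrightarrow> fin_digraph D \<and> \<not> (\<exists>p. pre_digraph.cycle D p) \<and> WE_functional D \<and>
     weakly_connected D \<and> inner_verts D \<noteq> {}"

definition basic_D_graph :: "('v, 'e) pre_digraph \<Rightarrow> bool" where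
  "basic_D_graph D \<longleftrightarrow> D_graph D \<and> (\<exists>v. inner_verts D = {v})"


definition juncture_verts :: "('v, 'e) pre_digraph \<Rightarrow> ('v, 'e) pre_digraph \<Rightarrow> 'v set" where
  "juncture_verts D\<^sub>W D\<^sub>E = head D\<^sub>W ` (arcs D\<^sub>W \<inter> arcs D\<^sub>E)"

definition juncture_defined :: "('v, 'e) pre_digraph \<Rightarrow> ('v, 'e) pre_digraph \<Rightarrow> bool" where
  "juncture_defined D\<^sub>W D\<^sub>E \<longleftrightarrow> D_graph D\<^sub>W \<and> D_graph D\<^sub>E \<and> arcs D\<^sub>W \<inter> arcs D\<^sub>E \<noteq> {} \<and>
     (\<forall>a \<in> arcs D\<^sub>W \<inter> arcs D\<^sub>E. head D\<^sub>W a = tail D\<^sub>E a \<and>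
        a \<in> side_edges East D\<^sub>W \<and> a \<in> side_edges West D\<^sub>E) \<and>
     verts D\<^sub>W \<inter> verts D\<^sub>E = juncture_verts D\<^sub>W D\<^sub>E"

definition juncture ::
    "('v, 'e) pre_digraph \<Rightarrow> ('v, 'e) pre_digraph \<Rightarrow> ('v, 'e) pre_digraph" where
  "juncture D\<^sub>W D\<^sub>E =
     \<lparr> verts = (verts D\<^sub>W \<union> verts D\<^sub>E) - juncture_verts D\<^sub>W D\<^sub>E,
       arcs = arcs D\<^sub>W \<union> arcs D\<^sub>E,
       tail = (\<lambda>a. if a \<in> arcs D\<^sub>W then tail D\<^sub>W a else tail D\<^sub>E a),
       head = (\<lambda>a. if a \<in> arcs D\<^sub>E then head D\<^sub>E a else head D\<^sub>W a) \<rparr>"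


text \<open>
  Compatibility is a symmetric relation: either list may play either role in each of the two
  forms. The common part \<open>\<Xi>\<close> is kept as a parameter; the constructions below refer to it.
\<close>

definition compatible_lists_via :: "'a list \<Rightarrow> 'a list \<Rightarrow> 'a list \<Rightarrow> bool" where
  "compatible_lists_via \<Xi> L M \<longleftrightarrow> \<Xi> \<noteq> [] \<and>
     (\<exists>\<Phi> \<Psi>. distinct (\<Phi> @ \<Xi> @ \<Psi>) \<and>
        (L = \<Phi> @ \<Xi> \<and> M = \<Xi> @ \<Psi> \<or> M = \<Phi> @ \<Xi> \<and> L = \<Xi> @ \<Psi> \<or>
         L = \<Phi> @ \<Xi> @ \<Psi> \<and> M = \<Xi> \<or> M = \<Phi> @ \<Xi> @ \<Psi> \<and> L = \<Xi>))"

definition compatible_lists :: "'a list \<Rightarrow> 'a list \<Rightarrow> bool" where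
  "compatible_lists L M \<longleftrightarrow> (\<exists>\<Xi>. compatible_lists_via \<Xi> L M)"

definition list_of_side :: "side \<Rightarrow> ('v, 'e) pre_digraph \<Rightarrow> 'v list \<Rightarrow> bool" where
  "list_of_side X D L \<longleftrightarrow> distinct L \<and> set L = side_verts X D"


type_synonym ('v, 'e) cnode = "('v, 'e) pre_digraph \<times> 'v list \<times> 'v list"

datatype ('v, 'e) ctree =
    Leaf "('v, 'e) cnode"
  | Branch "('v, 'e) cnode" "('v, 'e) ctree" "('v, 'e) ctree"

fun root :: "('v, 'e) ctree \<Rightarrow> ('v, 'e) cnode" where
  "root (Leaf n) = n"
| "root (Branch n K K') = n"

inductive construction :: "('v, 'e) ctree \<Rightarrow> bool" where
  basic: "basic_D_graph D \<Longrightarrow> list_of_side West D L\<^sub>W \<Longrightarrow> list_of_side East D L\<^sub>E \<Longrightarrow>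
    construction (Leaf (D, L\<^sub>W, L\<^sub>E))"
| junct: "construction K\<^sub>W \<Longrightarrow> construction K\<^sub>E \<Longrightarrow>
    root K\<^sub>W = (D\<^sub>W, LW\<^sub>W, \<Phi>\<^sub>E @ \<Xi> @ \<Psi>\<^sub>E) \<Longrightarrow>
    root K\<^sub>E = (D\<^sub>E, \<Phi>\<^sub>W @ \<Xi> @ \<Psi>\<^sub>W, LE\<^sub>E) \<Longrightarrow>
    juncture_defined D\<^sub>W D\<^sub>E \<Longrightarrow>
    compatible_lists_via \<Xi> (\<Phi>\<^sub>E @ \<Xi> @ \<Psi>\<^sub>E) (\<Phi>\<^sub>W @ \<Xi> @ \<Psi>\<^sub>W) \<Longrightarrow>
    construction
      (Branch (juncture D\<^sub>W D\<^sub>E, \<Phi>\<^sub>W @ LW\<^sub>W @ \<Psi>\<^sub>W, \<Phi>\<^sub>E @ LE\<^sub>E @ \<Psi>\<^sub>E) K\<^sub>W K\<^sub>E)"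

definition P'_graph :: "('v, 'e) pre_digraph \<Rightarrow> bool" where
  "P'_graph D \<longleftrightarrow> (\<exists>K L\<^sub>W L\<^sub>E. construction K \<and> root K = (D, L\<^sub>W, L\<^sub>E))"


definition psi :: "side \<Rightarrow> ('v, 'e) pre_digraph \<Rightarrow> 'v \<Rightarrow> 'v \<Rightarrow> 'v \<Rightarrow> bool" where
  "psi X D v u w \<longleftrightarrow>
     (\<forall>(vs, es) \<in> semipaths D v w. \<forall>(us, fs) \<in> semipaths_to_side (opp X) D u.
        set vs \<inter> set us \<noteq> {})"

definition grounded :: "side \<Rightarrow> ('v, 'e) pre_digraph \<Rightarrow> 'v list \<Rightarrow> bool" where
  "grounded X D L \<longleftrightarrow> list_of_side X D L \<and>
     (\<forall>i j k. i < j \<and> j < k \<and> k < length L \<longrightarrow>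
        psi X D (L ! i) (L ! j) (L ! k) \<and> psi X D (L ! k) (L ! j) (L ! i))"

definition P_compatible :: "('v, 'e) pre_digraph \<Rightarrow> ('v, 'e) pre_digraph \<Rightarrow> bool" where
  "P_compatible D\<^sub>W D\<^sub>E \<longleftrightarrow> juncture_defined D\<^sub>W D\<^sub>E \<and>
     (\<exists>L M. grounded East D\<^sub>W L \<and> grounded West D\<^sub>E M \<and> compatible_lists L M)"


definition weak_components :: "('v, 'e) pre_digraph \<Rightarrow> ('v, 'e) pre_digraph set" where
  "weak_components D =
     {H. induced_subgraph H D \<and> verts H \<noteq> {} \<and> weakly_connected H \<and>
         \<not> (\<exists>H'. induced_subgraph H' D \<and> weakly_connected H' \<and> verts H \<subset> verts H')}"

definition cocycle ::
    "('v, 'e) pre_digraph \<Rightarrow> 'e set \<Rightarrow> ('v, 'e) pre_digraph \<Rightarrow> ('v, 'e) pre_digraph \<Rightarrow> bool" where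
  "cocycle D C D\<^sub>1 D\<^sub>2 \<longleftrightarrow> C \<noteq> {} \<and> C \<subseteq> inner_edges D \<and>
     weak_components (D\<lparr>arcs := arcs D - C\<rparr>) = {D\<^sub>1, D\<^sub>2} \<and> D\<^sub>1 \<noteq> D\<^sub>2 \<and>
     (\<forall>a \<in> C. tail D a \<in> verts D\<^sub>1 \<and> head D a \<in> verts D\<^sub>2)"

text \<open>
  The vertex type of the graphs obtained by cutting is \<^typ>\<open>'v + 'e\<close>: an old vertex \<open>v\<close> is
  \<open>Inl v\<close>, and the new vertex \<open>v\<^sub>a\<close> is \<open>Inr a\<close>, so fresh vertices exist whatever the type \<open>'v\<close>.
\<close>

definition cut_West ::
    "('v, 'e) pre_digraph \<Rightarrow> 'e set \<Rightarrow> ('v, 'e) pre_digraph \<Rightarrow> ('v + 'e, 'e) pre_digraph" where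
  "cut_West D C D\<^sub>1 =
     \<lparr> verts = Inl ` verts D\<^sub>1 \<union> Inr ` C,
       arcs = arcs D\<^sub>1 \<union> C,
       tail = (\<lambda>a. Inl (tail D a)),
       head = (\<lambda>a. if a \<in> C then Inr a else Inl (head D a)) \<rparr>"

definition cut_East ::
    "('v, 'e) pre_digraph \<Rightarrow> 'e set \<Rightarrow> ('v, 'e) pre_digraph \<Rightarrow> ('v + 'e, 'e) pre_digraph" where
  "cut_East D C D\<^sub>2 =
     \<lparr> verts = Inl ` verts D\<^sub>2 \<union> Inr ` C,
       arcs = arcs D\<^sub>2 \<union> C,
       tail = (\<lambda>a. if a \<in> C then Inr a else Inl (tail D a)),
       head = (\<lambda>a. Inl (head D a)) \<rparr>"

definition P'''_graph :: "('v, 'e) pre_digraph \<Rightarrow> bool" where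
  "P'''_graph D \<longleftrightarrow> D_graph D \<and>
     (\<forall>C D\<^sub>1 D\<^sub>2. cocycle D C D\<^sub>1 D\<^sub>2 \<longrightarrow> P_compatible (cut_West D C D\<^sub>1) (cut_East D C D\<^sub>2))"

end

(*
  A construction tells how to sweep its graph from west to east: the current front is a list of
  edges, and passing an inner vertex replaces its in-edges, which are contiguous in the front, by
  its out-edges. For a juncture one sweeps the western graph and then the eastern one.

  Given a cocycle, no edge leads from its eastern part back to the western one, so neighbouring
  steps of the sweep commute until all vertices of the western part come first. The front M
  reached at that moment contains the cocycle, and listing the edges of M in the two cut graphs
  gives the required lists.

  The lists are grounded by a parity argument. Let p be a semipath between two eastern vertices v
  and w. For an edge f in a front, count modulo 2 the edges of p before f. Since p has
  even degree at each inner vertex, this does not depend on the front, and it is constant along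
  every semipath avoiding p. It is 0 on western edges, but 1 on an eastern edge between v and w.
  The same count, for a single edge e of M outside the cocycle, shows that the connected part of
  the graph beyond the cocycle from e lies on one side of e, whence compatibility.
*)

theory Submission
  imports Defs
begin

section \<open>Orientation reversal and weak connectedness\<close>

text \<open>A cocycle of the whole graph may cut across the tree of a construction, so induction
  over the tree does not reach its two halves. The tree is therefore used once, to obtain a linear
  sweep, and is then forgotten. Fronts list edges rather than vertices because edges keep their
  identity in junctures and cuts, whereas vertices disappear or are renamed: the same list
  \<open>M\<close> is read by heads in the western cut graph and by tails in the eastern one. The
  parity count takes the place of planarity: a front acts as a transversal line, a semipath as a
  curve, and the number of crossings before an edge tells on which side of the curve it lies,
  without any drawing. Reversing all edges exchanges the two sides, so most eastern statements are
  obtained from western ones through \<open>flip\<close>.\<close>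

definition flip :: "('v, 'e) pre_digraph \<Rightarrow> ('v, 'e) pre_digraph" where
  "flip D = \<lparr> verts = verts D, arcs = arcs D, tail = head D, head = tail D \<rparr>"

lemma flip_simps [simp]:
  "verts (flip D) = verts D" "arcs (flip D) = arcs D"
  "tail (flip D) = head D" "head (flip D) = tail D"
  "in_arcs (flip D) = out_arcs D" "out_arcs (flip D) = in_arcs D"
  by (auto simp: flip_def in_arcs_def out_arcs_def fun_eq_iff)

lemma flip_flip [simp]: "flip (flip D) = D"
  by (simp add: flip_def)

lemma opp_opp [simp]: "opp (opp X) = X"
  by (cases X) auto

lemma endpoint_flip [simp]: "endpoint X (flip D) = endpoint (opp X) D"
  by (cases X) (auto simp: fun_eq_iff)

lemma side_verts_flip [simp]: "side_verts X (flip D) = side_verts (opp X) D"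
  by (simp add: side_verts_def)

lemma side_edges_flip [simp]: "side_edges X (flip D) = side_edges (opp X) D"
  by (simp add: side_edges_def)

lemma inner_verts_flip [simp]: "inner_verts (flip D) = inner_verts D"
  by (auto simp: inner_verts_def)

lemma inner_edges_flip [simp]: "inner_edges (flip D) = inner_edges D"
  by (auto simp: inner_edges_def)

lemma joins_flip [simp]: "joins (flip D) = joins D"
  by (auto simp: joins_def fun_eq_iff)

lemma semipath_flip [simp]: "semipath (flip D) = semipath D"
  by (auto simp: semipath_def fun_eq_iff)

lemma semipaths_flip [simp]: "semipaths (flip D) = semipaths D"
  by (auto simp: semipaths_def fun_eq_iff)

lemma semipaths_to_side_flip [simp]: "semipaths_to_side X (flip D) = semipaths_to_side (opp X) D"
  by (auto simp: semipaths_to_side_def fun_eq_iff)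

lemma weakly_connected_flip [simp]: "weakly_connected (flip D) = weakly_connected D"
  by (simp add: weakly_connected_def)

lemma all_side: "(\<forall>X. P X) \<longleftrightarrow> P West \<and> P East"
  by (metis side.exhaust)

lemma WE_functional_flip [simp]: "WE_functional (flip D) = WE_functional D"
  by (auto simp: WE_functional_def all_side)

lemma wf_digraph_flip [simp]: "wf_digraph (flip D) = wf_digraph D"
  by (auto simp: wf_digraph_def)

lemma fin_digraph_flip [simp]: "fin_digraph (flip D) = fin_digraph D"
  by (simp add: fin_digraph_def fin_digraph_axioms_def)

lemma grounded_flip [simp]: "grounded X (flip D) L = grounded (opp X) D L"
  by (simp add: grounded_def psi_def list_of_side_def)

section \<open>Semipaths and reachability\<close>

definition adj :: "('v, 'e) pre_digraph \<Rightarrow> ('v \<times> 'v) set" where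
  "adj D = {(u, v). \<exists>a. joins D a u v}"

lemma joins_sym: "joins D a u v \<Longrightarrow> joins D a v u"
  by (auto simp: joins_def)

lemma adj_rtrancl_sym: "(u, v) \<in> (adj D)\<^sup>* \<Longrightarrow> (v, u) \<in> (adj D)\<^sup>*"
proof -
  have "sym (adj D)" by (auto simp: sym_def adj_def intro: joins_sym)
  then show "(u, v) \<in> (adj D)\<^sup>* \<Longrightarrow> (v, u) \<in> (adj D)\<^sup>*"
    by (metis sym_rtrancl symD)
qed

lemma semipath_take:
  assumes "semipath D vs es" "i < length vs"
  shows "semipath D (take (Suc i) vs) (take i es)"
  using assms by (auto simp: semipath_def dest: in_set_takeD)

lemma semipath_snoc:
  assumes "semipath D vs es" "joins D a (last vs) v" "v \<in> verts D" "v \<notin> set vs"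
  shows "semipath D (vs @ [v]) (es @ [a])"
  unfolding semipath_def
proof (intro conjI allI impI)
  fix i assume i: "i < length (es @ [a])"
  have len: "length vs = Suc (length es)" using assms by (simp add: semipath_def)
  show "joins D ((es @ [a]) ! i) ((vs @ [v]) ! i) ((vs @ [v]) ! Suc i)"
  proof (cases "i < length es")
    case True
    then show ?thesis using assms len by (simp add: semipath_def nth_append)
  next
    case False
    then have "i = length es" using i by simp
    moreover have "last vs = vs ! length es" using len by (cases "vs = []") (auto simp: last_conv_nth)
    ultimately show ?thesis using assms len by (simp add: nth_append)
  qed
qed (use assms in \<open>auto simp: semipath_def\<close>)

lemma semipath_imp_adj:
  assumes "length vs = Suc (length es)" "\<forall>i < length es. joins D (es ! i) (vs ! i) (vs ! Suc i)"
  shows "(hd vs, last vs) \<in> (adj D)\<^sup>*"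
  using assms
proof (induction es arbitrary: vs)
  case Nil
  then show ?case by (cases vs) auto
next
  case (Cons a es)
  obtain u v vs' where vs: "vs = u # v # vs'"
    using Cons.prems(1) by (auto simp: length_Suc_conv)
  have "joins D a u v" using Cons.prems(2)[rule_format, of 0] vs by simp
  then have "(u, v) \<in> adj D" by (auto simp: adj_def)
  moreover have "(hd (v # vs'), last (v # vs')) \<in> (adj D)\<^sup>*"
  proof (rule Cons.IH)
    show "\<forall>i<length es. joins D (es ! i) ((v # vs') ! i) ((v # vs') ! Suc i)"
      using Cons.prems(2) vs by auto
  qed (use Cons.prems vs in auto)
  ultimately show ?case using vs by (simp add: converse_rtrancl_into_rtrancl)
qed

text \<open>The semipath grows by one edge at a time; if the new vertex is already on it, it is cut
  off at that vertex instead, which keeps the vertices distinct.\<close>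

lemma adj_imp_semipaths:
  assumes "wf_digraph D" "u \<in> verts D" "(u, v) \<in> (adj D)\<^sup>*"
  shows "semipaths D u v \<noteq> {}"
  using assms(3)
proof (induction rule: rtrancl_induct)
  case base
  have "semipath D [u] []" using assms by (simp add: semipath_def)
  then show ?case by (force simp: semipaths_def)
next
  case (step y z)
  obtain vs es where p: "semipath D vs es" "hd vs = u" "last vs = y"
    using step.IH by (auto simp: semipaths_def)
  obtain a where a: "joins D a y z" using step.hyps(2) by (auto simp: adj_def)
  have z: "z \<in> verts D" using a assms(1) by (auto simp: joins_def wf_digraph_def)
  have ne: "vs \<noteq> []" using p(1) by (auto simp: semipath_def)
  show ?case
  proof (cases "z \<in> set vs")
    case True
    then obtain i where i: "i < length vs" "vs ! i = z" by (auto simp: in_set_conv_nth)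
    have "semipath D (take (Suc i) vs) (take i es)" using semipath_take[OF p(1) i(1)] .
    moreover have "hd (take (Suc i) vs) = u" using p(2) by (cases vs) auto
    moreover have "last (take (Suc i) vs) = z" using i by (simp add: take_Suc_conv_app_nth)
    ultimately have "(take (Suc i) vs, take i es) \<in> semipaths D u z" by (simp add: semipaths_def)
    then show ?thesis by blast
  next
    case False
    have "semipath D (vs @ [z]) (es @ [a])" using semipath_snoc[OF p(1) _ z False] a p(3) by simp
    then have "(vs @ [z], es @ [a]) \<in> semipaths D u z" using p(2) ne by (simp add: semipaths_def)
    then show ?thesis by blast
  qed
qed

lemma semipaths_imp_adj:
  assumes "semipaths D u v \<noteq> {}"
  shows "(u, v) \<in> (adj D)\<^sup>*"
proof -
  obtain vs es where "semipath D vs es" "hd vs = u" "last vs = v"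
    using assms by (auto simp: semipaths_def)
  then show ?thesis using semipath_imp_adj[of vs es D] by (simp add: semipath_def)
qed

text \<open>Semipaths forbid repeated vertices and so cannot simply be concatenated. The closure of
  \<open>adj\<close> is transitive, which makes connectedness proofs for junctures and cuts a matter
  of composing relations.\<close>

lemma weakly_connected_iff_adj:
  "wf_digraph D \<Longrightarrow>
     weakly_connected D \<longleftrightarrow> (\<forall>u \<in> verts D. \<forall>v \<in> verts D. (u, v) \<in> (adj D)\<^sup>*)"
  unfolding weakly_connected_def
  by (intro ball_cong refl iffI) (erule semipaths_imp_adj, erule (2) adj_imp_semipaths)

lemma adj_rtrancl_closed:
  assumes "(u, v) \<in> (adj D)\<^sup>*" "u \<in> Z"
    and "\<And>a. a \<in> arcs D \<Longrightarrow> tail D a \<in> Z \<longleftrightarrow> head D a \<in> Z"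
  shows "v \<in> Z"
  using assms(1,2)
proof induction
  case (step y z)
  then obtain a where "joins D a y z" by (auto simp: adj_def)
  then show ?case using step assms(3)[of a] by (auto simp: joins_def)
qed

lemma adj_rtrancl_map:
  assumes "(u, v) \<in> (adj D)\<^sup>*"
    and "\<And>a u v. joins D a u v \<Longrightarrow> (h u, h v) \<in> (adj G)\<^sup>*"
  shows "(h u, h v) \<in> (adj G)\<^sup>*"
  using assms(1)
proof induction
  case (step y z)
  then obtain a where "joins D a y z" by (auto simp: adj_def)
  then show ?case using step.IH assms(2) by (meson rtrancl_trans)
qed simp

section \<open>Acyclicity by ranks\<close>

text \<open>Acyclicity as a strictly increasing numbering of the vertices: numberings of two graphs
  are easily combined or extended, whereas a cycle in a juncture or a cut graph would have to be
  taken apart.\<close>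

definition ranked :: "('v, 'e) pre_digraph \<Rightarrow> bool" where
  "ranked D \<longleftrightarrow> (\<exists>r :: 'v \<Rightarrow> nat. \<forall>a \<in> arcs D. r (tail D a) < r (head D a))"

lemma ranked_imp_acyclic:
  assumes "ranked D"
  shows "\<not> pre_digraph.cycle D p"
proof
  obtain r :: "'a \<Rightarrow> nat" where r: "\<And>a. a \<in> arcs D \<Longrightarrow> r (tail D a) < r (head D a)"
    using assms by (auto simp: ranked_def)
  have mono: "r u + length q \<le> r v" if "set q \<subseteq> arcs D" "pre_digraph.cas D u q v" for q u v
    using that
  proof (induction q arbitrary: u)
    case Nil
    then show ?case by (simp add: pre_digraph.cas.simps)
  next
    case (Cons a q)
    have "r (head D a) + length q \<le> r v" using Cons by (simp add: pre_digraph.cas.simps)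
    moreover have "r u < r (head D a)" using r[of a] Cons.prems by (simp add: pre_digraph.cas.simps)
    ultimately show ?case by simp
  qed
  assume "pre_digraph.cycle D p"
  then obtain u where "set p \<subseteq> arcs D" "pre_digraph.cas D u p u" "p \<noteq> []"
    by (auto simp: pre_digraph.cycle_def pre_digraph.awalk_def)
  then show False using mono[of p u u] by simp
qed

lemma acyclic_imp_ranked:
  assumes fin: "fin_digraph D" and acyc: "\<not> (\<exists>p. pre_digraph.cycle D p)"
  shows "ranked D"
proof -
  interpret fin_digraph D by fact
  have irr: "(u, u) \<notin> (arcs_ends D)\<^sup>+" for u
    using acyc closed_w_imp_cycle reachable1_awalk[of u u] by (auto simp: closed_w_def)
  \<comment> \<open>The rank counts the proper ancestors of \<open>v\<close>. Along an edge it grows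
    strictly: the tail is an ancestor of the head but, by acyclicity, not of itself.\<close>
  define r where "r v = card {u. (u, v) \<in> (arcs_ends D)\<^sup>+}" for v
  have "r (tail D a) < r (head D a)" if a: "a \<in> arcs D" for a
    unfolding r_def
  proof (rule psubset_card_mono)
    have e: "(tail D a, head D a) \<in> arcs_ends D" using a by (auto simp: arcs_ends_conv)
    have "{u. (u, head D a) \<in> (arcs_ends D)\<^sup>+} \<subseteq> verts D"
      using reachable1_in_verts by auto
    then show "finite {u. (u, head D a) \<in> (arcs_ends D)\<^sup>+}"
      by (rule finite_subset) simp
    show "{u. (u, tail D a) \<in> (arcs_ends D)\<^sup>+} \<subset> {u. (u, head D a) \<in> (arcs_ends D)\<^sup>+}"
      using e irr[of "tail D a"] by (blast intro: trancl_into_trancl)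
  qed
  then show ?thesis by (auto simp: ranked_def)
qed

lemma ranked_flip:
  assumes "fin_digraph D" "ranked D"
  shows "ranked (flip D)"
proof -
  obtain r :: "'a \<Rightarrow> nat" where r: "\<And>a. a \<in> arcs D \<Longrightarrow> r (tail D a) < r (head D a)"
    using assms by (auto simp: ranked_def)
  interpret fin_digraph D by fact
  have "Max (r ` verts D) - r (head D a) < Max (r ` verts D) - r (tail D a)"
    if "a \<in> arcs D" for a
  proof -
    \<comment> \<open>Subtraction on the naturals is truncated; this bound is what keeps the
      reversed inequality strict.\<close>
    have "r (head D a) \<le> Max (r ` verts D)" using that by simp
    then show ?thesis using r[OF that] by linarith
  qed
  then show ?thesis unfolding ranked_def by (auto intro!: exI[of _ "\<lambda>v. Max (r ` verts D) - r v"])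
qed

lemma D_graph_iff_ranked:
  "D_graph D \<longleftrightarrow> fin_digraph D \<and> ranked D \<and> WE_functional D \<and> weakly_connected D \<and> inner_verts D \<noteq> {}"
  unfolding D_graph_def by (metis acyclic_imp_ranked ranked_imp_acyclic)

lemma D_graph_flip: "D_graph (flip D) \<longleftrightarrow> D_graph D"
  unfolding D_graph_iff_ranked using ranked_flip[of D] ranked_flip[of "flip D"] by auto

section \<open>Degrees of side vertices\<close>

lemma D_graph_fin: "D_graph D \<Longrightarrow> fin_digraph D"
  and D_graph_wf: "D_graph D \<Longrightarrow> wf_digraph D"
  by (auto simp: D_graph_def fin_digraph_def)

lemma D_graph_adj:
  "D_graph D \<Longrightarrow> u \<in> verts D \<Longrightarrow> v \<in> verts D \<Longrightarrow> (u, v) \<in> (adj D)\<^sup>*"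
  by (metis D_graph_def D_graph_wf weakly_connected_iff_adj)

lemma D_graph_no_loop: "D_graph D \<Longrightarrow> a \<in> arcs D \<Longrightarrow> tail D a \<noteq> head D a"
  by (force simp: D_graph_iff_ranked ranked_def)

lemma in_side_verts_West: "v \<in> side_verts West D \<longleftrightarrow> v \<in> verts D \<and> in_arcs D v = {}"
  and in_side_verts_East: "v \<in> side_verts East D \<longleftrightarrow> v \<in> verts D \<and> out_arcs D v = {}"
  by (auto simp: side_verts_def in_arcs_def out_arcs_def)

lemma West_edge_unique:
  "D_graph D \<Longrightarrow> a \<in> side_edges West D \<Longrightarrow> b \<in> arcs D \<Longrightarrow> tail D b = tail D a \<Longrightarrow> b = a"
  unfolding D_graph_def WE_functional_def by (metis endpoint.simps(1))

lemma East_edge_unique: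
  "D_graph D \<Longrightarrow> a \<in> side_edges East D \<Longrightarrow> b \<in> arcs D \<Longrightarrow> head D b = head D a \<Longrightarrow> b = a"
  unfolding D_graph_def WE_functional_def by (metis endpoint.simps(2))

text \<open>Some inner vertex exists and is connected to \<open>v\<close>, which provides an edge at
  \<open>v\<close>; it must leave \<open>v\<close>, and functionality makes it the only one.\<close>

lemma West_vert_arc:
  assumes "D_graph D" "v \<in> side_verts West D"
  obtains a where "a \<in> arcs D" "tail D a = v" "out_arcs D v = {a}"
proof -
  have v: "v \<in> verts D" "in_arcs D v = {}" using assms(2) by (auto simp: in_side_verts_West)
  obtain x where x: "x \<in> inner_verts D" using assms(1) by (auto simp: D_graph_def)
  then have "x \<in> verts D" "x \<noteq> v" using assms(2) by (auto simp: inner_verts_def)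
  then have "(v, x) \<in> (adj D)\<^sup>*" using D_graph_adj[OF assms(1) v(1)] by simp
  then obtain y a where "joins D a v y"
    using \<open>x \<noteq> v\<close> by (auto simp: adj_def elim: converse_rtranclE)
  then have a: "a \<in> arcs D" "tail D a = v" using v by (auto simp: joins_def in_arcs_def)
  then have "a \<in> side_edges West D" using assms(2) by (simp add: side_edges_def)
  then have "out_arcs D v = {a}"
    using West_edge_unique[OF assms(1)] a by (auto simp: out_arcs_def)
  then show ?thesis by (rule that[OF a])
qed

lemma East_vert_arc:
  assumes "D_graph D" "v \<in> side_verts East D"
  obtains a where "a \<in> arcs D" "head D a = v" "in_arcs D v = {a}"
proof -
  have "D_graph (flip D)" "v \<in> side_verts West (flip D)" using assms by (simp_all add: D_graph_flip)
  from West_vert_arc[OF this] show ?thesis using that by (metis flip_simps(2,3,6))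
qed

lemma not_West_and_East: "D_graph D \<Longrightarrow> side_verts West D \<inter> side_verts East D = {}"
proof -
  assume D: "D_graph D"
  have False if "v \<in> side_verts West D" "v \<in> side_verts East D" for v
    using that(2) West_vert_arc[OF D that(1)] by (metis in_side_verts_East insert_not_empty)
  then show ?thesis by blast
qed

lemma side_edges_subset: "side_edges X D \<subseteq> arcs D"
  by (auto simp: side_edges_def)

lemma tail_not_East:
  "wf_digraph D \<Longrightarrow> a \<in> arcs D \<Longrightarrow> tail D a \<in> side_verts West D \<union> inner_verts D - side_verts East D"
  using wf_digraph.tail_in_verts[of D a]
  by (auto simp: inner_verts_def in_side_verts_West in_side_verts_East out_arcs_def)

lemma head_not_West:
  "wf_digraph D \<Longrightarrow> a \<in> arcs D \<Longrightarrow> head D a \<in> side_verts East D \<union> inner_verts D - side_verts West D"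
  using wf_digraph.head_in_verts[of D a]
  by (auto simp: inner_verts_def in_side_verts_West in_side_verts_East in_arcs_def)

lemma inner_verts_subset: "inner_verts D \<subseteq> verts D"
  by (auto simp: inner_verts_def)

lemma inner_vert_arcs:
  assumes "v \<in> inner_verts D"
  shows "in_arcs D v \<noteq> {}" "out_arcs D v \<noteq> {}"
  using assms by (auto simp: inner_verts_def in_side_verts_West in_side_verts_East)

lemma verts_cases:
  assumes "v \<in> verts D"
  obtains "v \<in> side_verts West D" | "v \<in> side_verts East D" | "v \<in> inner_verts D"
  using assms unfolding inner_verts_def by blast

section \<open>Sweeping a graph from west to east\<close>

text \<open>Here \<open>S\<close> is the first front, \<open>T\<close> the last one, and the vertex
  list records the order of passing. Only contiguity of the in-edges is demanded; the out-edges may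
  be inserted in any order. A front may contain edges outside \<open>G\<close>: in a cut graph they
  are the edges of the other part, carried along as passive entries.\<close>

inductive run :: "('v, 'e) pre_digraph \<Rightarrow> 'e list \<Rightarrow> 'v list \<Rightarrow> 'e list \<Rightarrow> bool" for G where
  run_Nil: "run G S [] S"
| run_Cons: "set I = in_arcs G x \<Longrightarrow> distinct I \<Longrightarrow> set Z = out_arcs G x \<Longrightarrow> distinct Z \<Longrightarrow>
    run G (A @ Z @ B) xs T \<Longrightarrow> run G (A @ I @ B) (x # xs) T"

lemma run_append: "run G S xs M \<Longrightarrow> run G M ys T \<Longrightarrow> run G S (xs @ ys) T"
  by (induction rule: run.induct) (auto intro: run.intros)

lemma run_flip: "run G S xs T \<Longrightarrow> run (flip G) T (rev xs) S"
proof (induction rule: run.induct)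
  case (run_Cons I x Z A B xs T)
  have "run (flip G) (A @ Z @ B) [x] (A @ I @ B)"
    using run_Cons by (auto intro!: run.intros)
  then show ?case using run_append[OF run_Cons.IH] by simp
qed (simp add: run.intros)

lemma run_context: "run G S xs T \<Longrightarrow> run G (P @ S @ Q) xs (P @ T @ Q)"
proof (induction rule: run.induct)
  case (run_Cons I x Z A B xs T)
  have "run G ((P @ A) @ I @ (B @ Q)) (x # xs) (P @ T @ Q)"
    by (rule run.run_Cons) (use run_Cons in auto)
  then show ?case by simp
qed (rule run.intros)

text \<open>A step depends on a vertex only through its in-edges and out-edges. With
  \<open>h\<close> the identity this carries runs over to a juncture, with \<open>h\<close> the
  injection \<open>Inl\<close> to a cut graph.\<close>

lemma run_map:
  "run G S xs T \<Longrightarrow>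
     (\<And>x. x \<in> set xs \<Longrightarrow> in_arcs G' (h x) = in_arcs G x \<and> out_arcs G' (h x) = out_arcs G x) \<Longrightarrow>
     run G' S (map h xs) T"
  by (induction rule: run.induct) (auto intro!: run.intros)

lemma arcs_disjoint:
  "x \<noteq> y \<Longrightarrow> in_arcs G x \<inter> in_arcs G y = {}"
  "x \<noteq> y \<Longrightarrow> out_arcs G x \<inter> out_arcs G y = {}"
  by auto

lemma run_distinct_set:
  assumes "run G S xs T" "distinct S" "distinct xs" "\<And>x. x \<in> set xs \<Longrightarrow> out_arcs G x \<inter> set S = {}"
  shows "distinct T \<and> set T = (set S \<union> (\<Union>x\<in>set xs. out_arcs G x)) - (\<Union>x\<in>set xs. in_arcs G x)"
  using assms
proof (induction rule: run.induct)
  case (run_Cons I x Z A B xs T)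
  have x: "out_arcs G x \<inter> set (A @ I @ B) = {}"
    and xs: "\<And>y. y \<in> set xs \<Longrightarrow> out_arcs G y \<inter> set (A @ I @ B) = {}"
    using run_Cons.prems(3) by auto
  have neq: "y \<noteq> x" if "y \<in> set xs" for y using run_Cons.prems(2) that by auto
  have "out_arcs G y \<inter> set (A @ Z @ B) = {}" if "y \<in> set xs" for y
    using xs[OF that] arcs_disjoint(2)[OF neq[OF that], of G] run_Cons.hyps(3) by auto
  moreover have "distinct (A @ Z @ B)" using run_Cons.prems(1) run_Cons.hyps x by auto
  ultimately have IH: "distinct T"
    "set T = (set (A @ Z @ B) \<union> (\<Union>x\<in>set xs. out_arcs G x)) - (\<Union>x\<in>set xs. in_arcs G x)"
    using run_Cons.IH run_Cons.prems(2) by auto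
  have "set (A @ Z @ B) = (set (A @ I @ B) - in_arcs G x) \<union> out_arcs G x"
    using run_Cons.prems(1) run_Cons.hyps x by auto
  \<comment> \<open>Edges consumed at \<open>x\<close> are in the present front, hence by freshness
    are never emitted again; so all consumed edges may be subtracted at once at the end.\<close>
  moreover have "in_arcs G x \<inter> (out_arcs G x \<union> (\<Union>x\<in>set xs. out_arcs G x)) = {}"
    using run_Cons.hyps(1) x xs by auto
  ultimately have
    "set T = (set (A @ I @ B) \<union> (\<Union>y\<in>set (x # xs). out_arcs G y)) - (\<Union>y\<in>set (x # xs). in_arcs G y)"
    unfolding IH(2) by auto
  then show ?case using IH(1) by blast
qed auto

lemma append_eq_append_cases:
  assumes "xs @ ys = zs @ ts"
  obtains us where "xs = zs @ us" "us @ ys = ts" | us where "xs @ us = zs" "ys = us @ ts"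
  using assms by (metis append_eq_append_conv2)

lemma disjoint_infix_cases:
  assumes "A1 @ I @ B1 = A @ Z @ B" "I \<noteq> []" "Z \<noteq> []" "set I \<inter> set Z = {}"
  obtains Y where "A = A1 @ I @ Y" "B1 = Y @ Z @ B" | Y where "B = Y @ I @ B1" "A1 = A @ Z @ Y"
proof -
  from assms(1) consider us where "A1 = A @ us" "us @ I @ B1 = Z @ B"
    | us where "A1 @ us = A" "I @ B1 = us @ Z @ B"
    by (rule append_eq_append_cases)
  then show ?thesis
  proof cases
    case 1
    from 1(2) consider vs where "us = Z @ vs" "vs @ I @ B1 = B"
      | vs where "us @ vs = Z" "I @ B1 = vs @ B"
      by (rule append_eq_append_cases)
    then show ?thesis
    proof cases
      case (2 vs)
      \<comment> \<open>\<open>vs\<close> is the end of \<open>Z\<close> and begins where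
        \<open>I\<close> begins; if it were non-empty, its first element would lie in both
        blocks.\<close>
      have "vs = []"
      proof (rule ccontr)
        assume "vs \<noteq> []"
        then have "hd I = hd vs" using 2(2) assms(2) by (metis hd_append2)
        moreover have "hd vs \<in> set Z" using 2(1) \<open>vs \<noteq> []\<close> by auto
        ultimately show False using assms(2,4) by (metis disjoint_iff hd_in_set)
      qed
      then show ?thesis using that(2)[of "[]"] 1 2 by simp
    qed (use that(2) 1 in auto)
  next
    case 2
    from 2(2) consider vs where "I = us @ vs" "vs @ B1 = Z @ B"
      | vs where "I @ vs = us" "B1 = vs @ Z @ B"
      by (rule append_eq_append_cases)
    then show ?thesis
    proof cases
      case (1 vs)
      have "vs = []"
      proof (rule ccontr)
        assume "vs \<noteq> []"
        then have "hd vs = hd Z" using 1(2) assms(3) by (metis hd_append2)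
        moreover have "hd vs \<in> set I" using 1(1) \<open>vs \<noteq> []\<close> by auto
        ultimately show False using assms(3,4) by (metis disjoint_iff hd_in_set)
      qed
      then show ?thesis using that(1)[of "[]"] 1 2 by simp
    qed (use that(1) 2 in auto)
  qed
qed

text \<open>
  Steps that do not consume the infix \<open>Z\<close> do not depend on it; this is how steps are commuted.
\<close>

lemma run_infix:
  assumes "run G S ys M" "S = A @ Z @ B" "Z \<noteq> []"
    and "\<And>y. y \<in> set ys \<Longrightarrow> in_arcs G y \<noteq> {} \<and> in_arcs G y \<inter> set Z = {}"
  shows "\<exists>A' B'. M = A' @ Z @ B' \<and> (\<forall>I. run G (A @ I @ B) ys (A' @ I @ B'))"
  using assms
proof (induction arbitrary: A B rule: run.induct)
  case (run_Cons I1 x Z1 A1 B1 xs T)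
  have I1: "set I1 = in_arcs G x" "in_arcs G x \<noteq> {}" "in_arcs G x \<inter> set Z = {}"
    using run_Cons by auto
  have ne: "I1 \<noteq> []" and dj: "set I1 \<inter> set Z = {}" using I1 by auto
  from disjoint_infix_cases[OF run_Cons.prems(1) ne run_Cons.prems(2) dj] show ?case
  proof cases
    case (1 Y)
    obtain A' B' where T: "T = A' @ Z @ B'"
      and r: "\<And>I. run G ((A1 @ Z1 @ Y) @ I @ B) xs (A' @ I @ B')"
      using run_Cons.IH[of "A1 @ Z1 @ Y" B] 1 run_Cons.prems by auto
    have "run G (A @ I @ B) (x # xs) (A' @ I @ B')" for I
      using run.run_Cons[OF run_Cons.hyps(1-4), of A1 "Y @ I @ B"] r[of I] 1 by simp
    then show ?thesis using T by blast
  next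
    case (2 Y)
    obtain A' B' where T: "T = A' @ Z @ B'"
      and r: "\<And>I. run G (A @ I @ (Y @ Z1 @ B1)) xs (A' @ I @ B')"
      using run_Cons.IH[of A "Y @ Z1 @ B1"] 2 run_Cons.prems by auto
    have "run G (A @ I @ B) (x # xs) (A' @ I @ B')" for I
      using run.run_Cons[OF run_Cons.hyps(1-4), of "A @ I @ Y" B1] r[of I] 2 by simp
    then show ?thesis using T by blast
  qed
qed (auto intro: run.intros)

text \<open>The later steps are sorted by induction. If the first vertex \<open>x\<close> fails
  \<open>P\<close>, no step satisfying \<open>P\<close> consumes an out-edge of \<open>x\<close>, so
  the block \<open>Z\<close> survives all of them; by \<open>run_infix\<close> they can be carried
  out around \<open>I\<close> instead, with \<open>x\<close> passed afterwards. Both non-emptiness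
  conditions fix positions: an empty \<open>Z\<close> would leave no trace of where \<open>I\<close>
  was, and a vertex without in-edges could be inserted in the middle of \<open>Z\<close>.\<close>

lemma run_partition:
  assumes "run G S xs T" "\<And>x. x \<in> set xs \<Longrightarrow> in_arcs G x \<noteq> {} \<and> out_arcs G x \<noteq> {}"
    and "\<And>x y. x \<in> set xs \<Longrightarrow> y \<in> set xs \<Longrightarrow> \<not> P x \<Longrightarrow> P y \<Longrightarrow> in_arcs G y \<inter> out_arcs G x = {}"
  shows "\<exists>M. run G S (filter P xs) M \<and> run G M (filter (\<lambda>x. \<not> P x) xs) T"
  using assms
proof (induction rule: run.induct)
  case (run_Cons I x Z A B xs T)
  obtain M where M: "run G (A @ Z @ B) (filter P xs) M" "run G M (filter (\<lambda>x. \<not> P x) xs) T"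
    using run_Cons.IH run_Cons.prems by auto
  show ?case
  proof (cases "P x")
    case True
    then show ?thesis using M run.run_Cons[OF run_Cons.hyps(1-4) M(1)] by auto
  next
    case False
    have "Z \<noteq> []" using run_Cons.prems(1)[of x] run_Cons.hyps(3) by auto
    moreover have "in_arcs G y \<noteq> {} \<and> in_arcs G y \<inter> set Z = {}" if "y \<in> set (filter P xs)" for y
      using run_Cons.prems(1)[of y] run_Cons.prems(2)[of x y] run_Cons.hyps(3) False that by auto
    ultimately obtain A' B' where M': "M = A' @ Z @ B'"
      and r: "run G (A @ I @ B) (filter P xs) (A' @ I @ B')"
      using run_infix[OF M(1) refl] by blast
    have "run G (A' @ I @ B') (x # filter (\<lambda>x. \<not> P x) xs) T"
      by (rule run.run_Cons[OF run_Cons.hyps(1-4)]) (use M(2) M' in simp)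
    then show ?thesis using r False by auto
  qed
qed (auto intro: run.intros)

text \<open>The weight is kept general because it is used twice: in \<open>grounded_East_run\<close>
  it counts the occurrences of an edge in a semipath, in \<open>same_side\<close> it is the
  indicator of a single edge. For \<open>f\<close> outside \<open>S\<close> the value is the sum
  over all of \<open>S\<close>.\<close>

definition before :: "('e \<Rightarrow> nat) \<Rightarrow> 'e list \<Rightarrow> 'e \<Rightarrow> nat" where
  "before w S f = sum_list (map w (takeWhile (\<lambda>a. a \<noteq> f) S))"

lemma before_append:
  "before w (A @ B) f = (if f \<in> set A then before w A f else sum_list (map w A) + before w B f)"
  by (auto simp: before_def takeWhile_append)

lemma before_zero: "(\<And>a. a \<in> set S \<Longrightarrow> w a = 0) \<Longrightarrow> before w S f = 0"
  by (auto simp: before_def dest: set_takeWhileD)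

text \<open>A step exchanges two blocks whose total weights have the same parity, so edges to their
  right keep their value. The single predicate \<open>N\<close> thus gives the side of every edge in
  all fronts at once, and only the first and last front are exposed. Around a vertex whose edges
  have weight 0, the blocks consumed and emitted add nothing, so all their edges have the parity of
  what stands to their left.\<close>

lemma run_parity:
  assumes "run G S xs T" "distinct S" "distinct xs" "\<And>x. x \<in> set xs \<Longrightarrow> out_arcs G x \<inter> set S = {}"
    and "\<And>x. x \<in> set xs \<Longrightarrow> even (sum w (in_arcs G x) + sum w (out_arcs G x))"
  shows "\<exists>N. (\<forall>f \<in> set S. N f \<longleftrightarrow> odd (before w S f)) \<and> (\<forall>f \<in> set T. N f \<longleftrightarrow> odd (before w T f)) \<and>
    (\<forall>x \<in> set xs. (\<forall>a \<in> in_arcs G x \<union> out_arcs G x. w a = 0) \<longrightarrow>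
       (\<exists>b. \<forall>a \<in> in_arcs G x \<union> out_arcs G x. N a = b))"
  using assms
proof (induction rule: run.induct)
  case (run_Nil S)
  then show ?case by (auto intro: exI[of _ "\<lambda>f. odd (before w S f)"])
next
  case (run_Cons I x Z A B xs T)
  have x: "out_arcs G x \<inter> set (A @ I @ B) = {}"
    and xs: "\<And>y. y \<in> set xs \<Longrightarrow> out_arcs G y \<inter> set (A @ I @ B) = {}"
    using run_Cons.prems(3) by auto
  have neq: "y \<noteq> x" if "y \<in> set xs" for y using run_Cons.prems(2) that by auto
  have disj: "out_arcs G y \<inter> set (A @ Z @ B) = {}" if "y \<in> set xs" for y
    using xs[OF that] arcs_disjoint(2)[OF neq[OF that], of G] run_Cons.hyps(3) by auto
  have dist: "distinct (A @ Z @ B)" using run_Cons.prems(1) run_Cons.hyps x by auto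
  have ev: "even (sum w (in_arcs G y) + sum w (out_arcs G y))" if "y \<in> set (x # xs)" for y
    using run_Cons.prems(4) that .
  obtain N1 where N1: "\<And>f. f \<in> set (A @ Z @ B) \<Longrightarrow> N1 f \<longleftrightarrow> odd (before w (A @ Z @ B) f)"
    "\<And>f. f \<in> set T \<Longrightarrow> N1 f \<longleftrightarrow> odd (before w T f)"
    "\<And>y. y \<in> set xs \<Longrightarrow> \<forall>a \<in> in_arcs G y \<union> out_arcs G y. w a = 0 \<Longrightarrow>
       \<exists>b. \<forall>a \<in> in_arcs G y \<union> out_arcs G y. N1 a = b"
    using run_Cons.IH[OF dist _ disj] run_Cons.prems(2) ev by auto
  \<comment> \<open>Edges of \<open>I\<close> leave the front for good, so their value can be set
    here without disturbing the later fronts; every other edge takes its value from the rest of the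
    run.\<close>
  define N where "N f = (if f \<in> set I then odd (before w (A @ I @ B) f) else N1 f)" for f
  have sums: "sum_list (map w I) = sum w (in_arcs G x)" "sum_list (map w Z) = sum w (out_arcs G x)"
    using run_Cons.hyps by (auto simp: sum_list_distinct_conv_sum_set)
  have "N f \<longleftrightarrow> odd (before w (A @ I @ B) f)" if "f \<in> set (A @ I @ B)" for f
  proof (cases "f \<in> set I")
    case False
    then have "f \<in> set A \<or> f \<in> set B" using that by auto
    then have "N1 f \<longleftrightarrow> odd (before w (A @ Z @ B) f)" by (intro N1(1)) auto
    moreover have "f \<notin> set Z" using that x run_Cons.hyps(3) by auto
    moreover have "even (sum_list (map w I) + sum_list (map w Z))" using ev[of x] sums by simp
    ultimately show ?thesis using False by (auto simp: N_def before_append)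
  qed (simp add: N_def)
  moreover have "N f \<longleftrightarrow> odd (before w T f)" if "f \<in> set T" for f
  proof -
    have "run G (A @ I @ B) (x # xs) T" using run.run_Cons run_Cons.hyps by fast
    from run_distinct_set[OF this run_Cons.prems(1,2)] run_Cons.prems(3)
    have "f \<notin> set I" using that run_Cons.hyps(1) by auto
    then show ?thesis using N1(2)[OF that] by (simp add: N_def)
  qed
  moreover have "\<exists>b. \<forall>a \<in> in_arcs G y \<union> out_arcs G y. N a = b"
    if y: "y \<in> set (x # xs)" and w: "\<forall>a \<in> in_arcs G y \<union> out_arcs G y. w a = 0" for y
  proof (cases "y = x")
    case True
    \<comment> \<open>Both blocks stand directly after \<open>A\<close> and have weight 0
      throughout, so \<open>A\<close> alone determines the value.\<close>
    have "N a = odd (sum_list (map w A))" if a: "a \<in> in_arcs G x \<union> out_arcs G x" for a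
    proof (cases "a \<in> set I")
      case aI: True
      then have "a \<notin> set A" using run_Cons.prems(1) by auto
      moreover have "before w I a = 0" using w True run_Cons.hyps(1) by (auto intro: before_zero)
      ultimately show ?thesis using aI by (simp add: N_def before_append)
    next
      case False
      then have aZ: "a \<in> set Z" using a run_Cons.hyps(1,3) by auto
      then have "a \<notin> set A" using dist by auto
      moreover have "before w Z a = 0" using w True run_Cons.hyps(3) by (auto intro: before_zero)
      moreover have "N1 a \<longleftrightarrow> odd (before w (A @ Z @ B) a)" using aZ by (intro N1(1)) auto
      ultimately show ?thesis using False aZ by (simp add: N_def before_append)
    qed
    then show ?thesis using True by blast
  next
    case False
    then have y: "y \<in> set xs" using y by simp
    have "a \<notin> set I" if "a \<in> in_arcs G y \<union> out_arcs G y" for a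
      using that xs[OF y] arcs_disjoint(1)[OF False, of G] run_Cons.hyps(1) by auto
    then show ?thesis using N1(3)[OF y w] by (simp add: N_def)
  qed
  ultimately show ?case by blast
qed

section \<open>Groundedness by parity\<close>

abbreviation incident :: "('v, 'e) pre_digraph \<Rightarrow> 'v \<Rightarrow> 'e set" where
  "incident D v \<equiv> in_arcs D v \<union> out_arcs D v"

lemma sum_count_Cons:
  "finite A \<Longrightarrow> sum (count_list (a # es)) A = of_bool (a \<in> A) + sum (count_list es) A"
proof -
  assume "finite A"
  have "sum (count_list (a # es)) A = (\<Sum>b\<in>A. of_bool (a = b) + count_list es b)"
    by (intro sum.cong) auto
  then show ?thesis using \<open>finite A\<close> by (simp add: sum.distrib of_bool_def)
qed

text \<open>Each edge adds one to the degree at both of its ends. Along the sequence these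
  contributions cancel modulo 2 except at the first and the last vertex.\<close>

lemma semipath_degree:
  assumes "finite (arcs D)" "length vs = Suc (length es)"
    and "\<forall>i < length es. joins D (es ! i) (vs ! i) (vs ! Suc i)"
  shows "even (sum (count_list es) (in_arcs D x) + sum (count_list es) (out_arcs D x) +
    of_bool (hd vs = x) + of_bool (last vs = x))"
  using assms(2,3)
proof (induction es arbitrary: vs)
  case Nil
  then obtain v where "vs = [v]" by (auto simp: length_Suc_conv)
  then show ?case by simp
next
  case (Cons a es)
  obtain u v vs' where vs: "vs = u # v # vs'"
    using Cons.prems(1) by (auto simp: length_Suc_conv)
  have "joins D a u v" using Cons.prems(2)[rule_format, of 0] vs by simp
  then have a: "(of_bool (a \<in> in_arcs D x) + of_bool (a \<in> out_arcs D x) :: nat)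
      = of_bool (u = x) + of_bool (v = x)"
    by (auto simp: joins_def of_bool_def)
  have fin: "finite (in_arcs D x)" "finite (out_arcs D x)"
    using assms(1) by (auto simp: in_arcs_def out_arcs_def)
  have "even (sum (count_list es) (in_arcs D x) + sum (count_list es) (out_arcs D x) +
      of_bool (v = x) + of_bool (last (v # vs') = x))"
    using Cons.IH[of "v # vs'"] Cons.prems vs by fastforce
  moreover have "sum (count_list (a # es)) (in_arcs D x) + sum (count_list (a # es)) (out_arcs D x)
    = of_bool (u = x) + of_bool (v = x) +
      (sum (count_list es) (in_arcs D x) + sum (count_list es) (out_arcs D x))"
    unfolding sum_count_Cons[OF fin(1)] sum_count_Cons[OF fin(2)] using a by linarith
  ultimately show ?case unfolding vs list.sel last_ConsR[OF list.distinct(2)[of v vs']]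
    by presburger
qed

text \<open>Consecutive vertices share an edge, and this edge passes the common value of one vertex
  on to the next.\<close>

lemma constant_along_semipath:
  assumes "length us = Suc (length fs)" "\<forall>i < length fs. joins D (fs ! i) (us ! i) (us ! Suc i)"
    and "\<And>y. y \<in> set us \<Longrightarrow> \<exists>b. \<forall>a \<in> incident D y. N a = b"
    and "a \<in> incident D (hd us)" "b \<in> incident D (last us)"
  shows "N a = N b"
  using assms
proof (induction fs arbitrary: us a)
  case Nil
  then obtain v where "us = [v]" by (auto simp: length_Suc_conv)
  then show ?case using Nil.prems(3)[of v] Nil.prems(4,5) by (metis last.simps list.sel(1) list.set_intros(1))
next
  case (Cons f fs)
  obtain u v us' where us: "us = u # v # us'"
    using Cons.prems(1) by (auto simp: length_Suc_conv)
  have "joins D f u v" using Cons.prems(2)[rule_format, of 0] us by simp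
  then have f: "f \<in> incident D u" "f \<in> incident D v" by (auto simp: joins_def)
  have "N f = N b"
  proof (rule Cons.IH[of "v # us'"])
    show "\<forall>i<length fs. joins D (fs ! i) ((v # us') ! i) ((v # us') ! Suc i)"
      using Cons.prems(2) us by auto
    show "\<exists>b. \<forall>a \<in> incident D y. N a = b" if "y \<in> set (v # us')" for y
      using Cons.prems(3)[of y] us that by simp
    show "f \<in> incident D (hd (v # us'))" using f by simp
  qed (use Cons.prems us in auto)
  moreover have "N a = N f" using Cons.prems(3)[of u] Cons.prems(4) f us by (metis list.sel(1) list.set_intros(1))
  ultimately show ?case by simp
qed

lemma side_vert_incident:
  assumes "D_graph D" "y \<in> side_verts X D"
  obtains a where "incident D y = {a}"
proof (cases X)
  case West
  then have y: "y \<in> side_verts West D" using assms(2) by simp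
  from West_vert_arc[OF assms(1) y] obtain a where "out_arcs D y = {a}" .
  moreover have "in_arcs D y = {}" using y by (simp add: in_side_verts_West)
  ultimately show ?thesis using that[of a] by simp
next
  case East
  then have y: "y \<in> side_verts East D" using assms(2) by simp
  from East_vert_arc[OF assms(1) y] obtain a where "in_arcs D y = {a}" .
  moreover have "out_arcs D y = {}" using y by (simp add: in_side_verts_East)
  ultimately show ?thesis using that[of a] by simp
qed

lemma side_vert_incident_eq:
  assumes "D_graph D" "y \<in> side_verts X D" "a \<in> incident D y"
  shows "incident D y = {a}"
proof -
  from side_vert_incident[OF assms(1,2)] obtain b where "incident D y = {b}" .
  then show ?thesis using assms(3) by auto
qed

lemma before_filter:
  "P f \<Longrightarrow> (\<And>a. \<not> P a \<Longrightarrow> w a = 0) \<Longrightarrow> before w (filter P S) f = before w S f"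
  by (induction S) (auto simp: before_def)

lemma before_nth:
  assumes "distinct S" "j < length S"
  shows "before w S (S ! j) = (\<Sum>i<j. w (S ! i))"
proof -
  have S: "S = take j S @ S ! j # drop (Suc j) S" using assms(2) by (rule id_take_nth_drop)
  have "S ! j \<notin> set (take j S)"
    using assms by (auto simp: in_set_conv_nth nth_eq_iff_index_eq)
  then have "before w (take j S @ S ! j # drop (Suc j) S) (S ! j) = sum_list (map w (take j S))"
    by (simp add: before_append) (simp add: before_def)
  then have "before w S (S ! j) = sum_list (map w (take j S))" using S by simp
  also have "\<dots> = (\<Sum>i<j. w (S ! i))"
    using assms(2) by (simp add: sum_list_sum_nth lessThan_atLeast0 min_def)
  finally show ?thesis .
qed

lemma even_before:
  assumes "\<And>a. a \<in> set S \<Longrightarrow> even (w a)"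
  shows "even (before w S f)"
proof -
  have "even (sum_list (map w xs))" if "set xs \<subseteq> set S" for xs
    using that assms by (induction xs) auto
  then show ?thesis unfolding before_def by (meson set_takeWhileD subsetI)
qed

lemma run_fresh:
  assumes "set S \<inter> arcs G \<subseteq> side_edges West G" "x \<in> inner_verts G"
  shows "out_arcs G x \<inter> set S = {}"
  using assms by (auto simp: side_edges_def inner_verts_def)

text \<open>Every edge of \<open>G\<close> enters the front, at the start if its tail is a West
  vertex and otherwise when its tail is passed. It leaves the front exactly if its head is
  inner.\<close>

lemma run_East_edges:
  assumes G: "D_graph G" and r: "run G S xs M" and S: "distinct S" "set S \<inter> arcs G = side_edges West G"
    and xs: "distinct xs" "set xs = inner_verts G"
  shows "set M \<inter> arcs G = side_edges East G"
proof -
  have fresh: "out_arcs G x \<inter> set S = {}" if "x \<in> set xs" for x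
    using run_fresh[of S G x] that S(2) xs(2) by simp
  have M: "set M = (set S \<union> (\<Union>x\<in>set xs. out_arcs G x)) - (\<Union>x\<in>set xs. in_arcs G x)"
    using run_distinct_set[OF r S(1) xs(1) fresh] by simp
  have "a \<in> set M \<longleftrightarrow> a \<in> side_edges East G" if a: "a \<in> arcs G" for a
  proof -
    have "a \<in> set S \<longleftrightarrow> tail G a \<in> side_verts West G" using S(2) a by (auto simp: side_edges_def)
    then have "a \<in> set M \<longleftrightarrow> head G a \<notin> inner_verts G"
      unfolding M xs(2) using a tail_not_East[OF D_graph_wf[OF G] a] by auto
    also have "\<dots> \<longleftrightarrow> head G a \<in> side_verts East G"
      using head_not_West[OF D_graph_wf[OF G] a] by (auto simp: inner_verts_def)
    finally show ?thesis using a by (simp add: side_edges_def)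
  qed
  then show ?thesis by (auto simp: side_edges_def)
qed

lemma inj_on_head_East: "D_graph D \<Longrightarrow> inj_on (head D) (side_edges East D)"
  by (rule inj_onI) (metis East_edge_unique side_edges_subset subsetD)

lemma head_image_East:
  assumes "D_graph D"
  shows "head D ` side_edges East D = side_verts East D"
proof -
  have "v \<in> head D ` side_edges East D" if v: "v \<in> side_verts East D" for v
  proof -
    from East_vert_arc[OF assms v] obtain a where "a \<in> arcs D" "head D a = v" .
    then show ?thesis using v by (force simp: side_edges_def)
  qed
  then show ?thesis by (auto simp: side_edges_def)
qed

text \<open>\<open>S\<close> and \<open>M\<close> are allowed to contain edges outside
  \<open>G\<close>, as happens for the cut graphs; hence the intersection with \<open>arcs G\<close>
  and the filter. Such edges do not occur in semipaths of \<open>G\<close> and have weight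
  0.\<close>

lemma grounded_East_run:
  assumes G: "D_graph G" and r: "run G S xs M" and S: "distinct S" "set S \<inter> arcs G = side_edges West G"
    and xs: "distinct xs" "set xs = inner_verts G"
  shows "grounded East G (map (head G) (filter (\<lambda>a. a \<in> arcs G) M))"
proof -
  interpret fin_digraph G using G by (rule D_graph_fin)
  define F where "F = filter (\<lambda>a. a \<in> arcs G) M"
  define L where "L = map (head G) F"
  have fresh: "out_arcs G x \<inter> set S = {}" if "x \<in> set xs" for x
    using run_fresh[of S G x] that S(2) xs(2) by simp
  have distF: "distinct F"
    using run_distinct_set[OF r S(1) xs(1) fresh] by (simp add: F_def)
  have setF: "set F = side_edges East G"
    using run_East_edges[OF assms] by (auto simp: F_def)
  have list: "list_of_side East G L"
    unfolding list_of_side_def L_def using distF setF inj_on_head_East[OF G] head_image_East[OF G]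
    by (simp add: distinct_map)
  have lenL: "length L = length F" by (simp add: L_def)
  have East: "L ! t \<in> side_verts East G" if "t < length F" for t
    using list that lenL nth_mem[of t L] by (simp add: list_of_side_def)
  have inc_L: "incident G (L ! t) = {F ! t}" "out_arcs G (L ! t) = {}" "F ! t \<in> in_arcs G (L ! t)"
    if "t < length F" for t
  proof -
    have "F ! t \<in> side_edges East G" using setF that nth_mem by blast
    then show *: "F ! t \<in> in_arcs G (L ! t)" using that by (simp add: L_def side_edges_def)
    show "out_arcs G (L ! t) = {}" using East[OF that] by (simp add: in_side_verts_East)
    show "incident G (L ! t) = {F ! t}"
      using * by (intro side_vert_incident_eq[OF G East[OF that]]) simp
  qed
  \<comment> \<open>The cardinality condition says that exactly one end of the semipath precedes
    \<open>L ! j\<close> in the list. It is symmetric in \<open>i\<close> and \<open>k\<close> and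
    so serves both orders required by \<open>grounded\<close>.\<close>
  have psi: "psi East G (L ! i) (L ! j) (L ! k)"
    if ijk: "i < length F" "j < length F" "k < length F" and card: "card {t. t < j \<and> (t = i \<or> t = k)} = 1"
      and "i \<noteq> k" for i j k
    unfolding psi_def
  proof (intro ballI, clarify)
    fix vs es us fs
    assume p: "(vs, es) \<in> semipaths G (L ! i) (L ! k)"
      and q: "(us, fs) \<in> semipaths_to_side (opp East) G (L ! j)" and disj: "set vs \<inter> set us = {}"
    have p': "length vs = Suc (length es)" "\<forall>i < length es. joins G (es ! i) (vs ! i) (vs ! Suc i)"
      "hd vs = L ! i" "last vs = L ! k" using p by (auto simp: semipaths_def semipath_def)
    have q': "length us = Suc (length fs)" "\<forall>i < length fs. joins G (fs ! i) (us ! i) (us ! Suc i)"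
      "hd us = L ! j" "last us \<in> side_verts West G" "set us \<subseteq> verts G"
      using q by (auto simp: semipaths_to_side_def semipaths_def semipath_def)
    define w where "w = count_list es"
    have es: "set es \<subseteq> arcs G" using p'(2) by (auto simp: joins_def in_set_conv_nth)
    have deg: "even (sum w (in_arcs G y) + sum w (out_arcs G y) + of_bool (L ! i = y) + of_bool (L ! k = y))"
      for y using semipath_degree[OF finite_arcs p'(1,2), of y] p'(3,4) by (simp add: w_def)
    have ev: "even (sum w (in_arcs G y) + sum w (out_arcs G y))" if "y \<notin> side_verts East G" for y
    proof -
      have "L ! i \<noteq> y" "L ! k \<noteq> y" using East[OF ijk(1)] East[OF ijk(3)] that by auto
      then show ?thesis using deg[of y] by simp
    qed
    have ev_inner: "even (sum w (in_arcs G y) + sum w (out_arcs G y))" if "y \<in> set xs" for y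
      using that xs(2) by (intro ev) (simp add: inner_verts_def)
    have "\<exists>N. (\<forall>f \<in> set S. N f \<longleftrightarrow> odd (before w S f)) \<and>
      (\<forall>f \<in> set M. N f \<longleftrightarrow> odd (before w M f)) \<and>
      (\<forall>y \<in> set xs. (\<forall>a \<in> incident G y. w a = 0) \<longrightarrow> (\<exists>b. \<forall>a \<in> incident G y. N a = b))"
      by (rule run_parity[OF r S(1) xs(1) fresh ev_inner])
    then obtain N where N: "\<forall>f \<in> set S. N f \<longleftrightarrow> odd (before w S f)"
      "\<forall>f \<in> set M. N f \<longleftrightarrow> odd (before w M f)"
      "\<forall>y \<in> set xs. (\<forall>a \<in> incident G y. w a = 0) \<longrightarrow> (\<exists>b. \<forall>a \<in> incident G y. N a = b)"
      by (elim exE conjE)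
    \<comment> \<open>An inner vertex of the second semipath is not on the first, so none of its
      edges has weight; a side vertex has only one edge.\<close>
    have const: "\<exists>b. \<forall>a \<in> incident G y. N a = b" if y: "y \<in> set us" for y
    proof -
      have "y \<in> verts G" using y q'(5) by blast
      then show ?thesis
      proof (cases rule: verts_cases)
        case 3
        have "w a = 0" if a: "a \<in> incident G y" for a
        proof (rule ccontr)
          assume "w a \<noteq> 0"
          then have "a \<in> set es" by (simp add: w_def count_list_0_iff)
          then obtain t where t: "t < length es" "es ! t = a" by (auto simp: in_set_conv_nth)
          then have "joins G a (vs ! t) (vs ! Suc t)" using p'(2) by blast
          then have "y = vs ! t \<or> y = vs ! Suc t" using a by (auto simp: joins_def)
          then have "y \<in> set vs" using t p'(1) nth_mem[of t vs] nth_mem[of "Suc t" vs] by auto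
          then show False using y disj by blast
        qed
        then show ?thesis using N(3) 3 xs(2) by simp
      next
        case 1
        from side_vert_incident[OF G this] obtain a where "incident G y = {a}" .
        then show ?thesis by auto
      next
        case 2
        from side_vert_incident[OF G this] obtain a where "incident G y = {a}" .
        then show ?thesis by auto
      qed
    qed
    from West_vert_arc[OF G q'(4)] obtain a where a: "a \<in> arcs G" "tail G a = last us" .
    have a_inc: "a \<in> incident G (last us)" using a by simp
    have "a \<in> side_edges West G" using a q'(4) by (simp add: side_edges_def)
    then have aS: "a \<in> set S" using S(2) by blast
    have "N (F ! j) = N a"
    proof (rule constant_along_semipath[OF q'(1,2) const _ a_inc])
      show "F ! j \<in> incident G (hd us)" using inc_L(3)[OF ijk(2)] q'(3) by simp
    qed
    moreover have "\<not> N a"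
    proof -
      \<comment> \<open>If \<open>b\<close> belongs to \<open>G\<close>, it is the only edge at its
        tail, a West vertex. Its weight is therefore the degree of the first semipath there, which
        is even because both ends of that semipath are East vertices.\<close>
      have "even (w b)" if b: "b \<in> set S" for b
      proof (cases "b \<in> arcs G")
        case True
        then have "b \<in> side_edges West G" using b S(2) by blast
        then have t: "tail G b \<in> side_verts West G" by (simp add: side_edges_def)
        then have "in_arcs G (tail G b) = {}" "out_arcs G (tail G b) = {b}"
          using side_vert_incident_eq[OF G t, of b] True t by (auto simp: in_side_verts_West)
        moreover have "tail G b \<notin> side_verts East G" using not_West_and_East[OF G] t by blast
        ultimately show ?thesis using ev[of "tail G b"] by simp
      next
        case False
        then have "b \<notin> set es" using es by blast
        then show ?thesis by (simp add: w_def count_list_0_iff)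
      qed
      then show ?thesis using N(1) aS even_before[of S w a] by simp
    qed
    moreover have "N (F ! j)"
    proof -
      have "F ! j \<in> set F" using ijk(2) by simp
      then have Fj: "F ! j \<in> set M" "F ! j \<in> arcs G" by (auto simp: F_def)
      have "w b = 0" if "b \<notin> arcs G" for b using that es by (auto simp: w_def count_list_0_iff)
      then have "before w M (F ! j) = before w F (F ! j)"
        unfolding F_def using before_filter[of "\<lambda>a. a \<in> arcs G" "F ! j" w M] Fj(2) F_def by simp
      also have "\<dots> = (\<Sum>t<j. w (F ! t))" by (rule before_nth[OF distF ijk(2)])
      finally have bef: "before w M (F ! j) = (\<Sum>t<j. w (F ! t))" .
      \<comment> \<open>\<open>F ! t\<close> is the only edge at \<open>L ! t\<close>, so its weight
        is the degree of the semipath at that vertex, odd precisely at the two distinct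
        ends.\<close>
      have "odd (w (F ! t)) \<longleftrightarrow> t = i \<or> t = k" if "t < length F" for t
      proof -
        have "in_arcs G (L ! t) = {F ! t}" using inc_L[OF that] by blast
        moreover have "L ! i = L ! t \<longleftrightarrow> t = i" "L ! k = L ! t \<longleftrightarrow> t = k"
          using list that ijk lenL by (auto simp: list_of_side_def nth_eq_iff_index_eq)
        ultimately show ?thesis using deg[of "L ! t"] inc_L(2)[OF that] \<open>i \<noteq> k\<close>
          by (auto simp: of_bool_def split: if_splits)
      qed
      then have "odd (w (F ! t)) \<longleftrightarrow> t = i \<or> t = k" if "t < j" for t
        using ijk(2) that by simp
      then have "{t \<in> {..<j}. odd (w (F ! t))} = {t. t < j \<and> (t = i \<or> t = k)}"
        by blast
      then have "odd (\<Sum>t<j. w (F ! t))" using card by (simp add: even_sum_iff)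
      then show ?thesis using N(2) Fj(1) bef by simp
    qed
    ultimately show False by simp
  qed
  have "psi East G (L ! i) (L ! j) (L ! k) \<and> psi East G (L ! k) (L ! j) (L ! i)"
    if "i < j" "j < k" "k < length L" for i j k
  proof -
    have "{t. t < j \<and> (t = i \<or> t = k)} = {i}" "{t. t < j \<and> (t = k \<or> t = i)} = {i}"
      using that by auto
    then show ?thesis using psi[of i j k] psi[of k j i] that lenL by simp
  qed
  then show ?thesis using list unfolding grounded_def L_def F_def by blast
qed

section \<open>Junctures\<close>

text \<open>In this form the property is local to the side vertices, where the in-edges and
  out-edges in junctures and cut graphs are known.\<close>

lemma WE_functional_iff:
  "WE_functional D \<longleftrightarrow>
    (\<forall>v \<in> side_verts West D. \<forall>a \<in> out_arcs D v. \<forall>b \<in> out_arcs D v. a = b) \<and>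
    (\<forall>v \<in> side_verts East D. \<forall>a \<in> in_arcs D v. \<forall>b \<in> in_arcs D v. a = b)"
  unfolding WE_functional_def all_side by (fastforce simp: side_edges_def)

lemma flip_juncture:
  "juncture_defined W E \<Longrightarrow> juncture (flip E) (flip W) = flip (juncture W E)"
  "juncture_defined W E \<Longrightarrow> juncture_defined (flip E) (flip W)"
proof -
  assume d: "juncture_defined W E"
  \<comment> \<open>\<open>juncture_verts\<close> is defined by heads in the western graph; it is
    invariant under reversal because these agree with the tails in the eastern one.\<close>
  have "tail E ` (arcs E \<inter> arcs W) = head W ` (arcs W \<inter> arcs E)"
    unfolding Int_commute[of "arcs E"]
    by (intro image_cong refl) (use d in \<open>simp add: juncture_defined_def\<close>)
  then have v: "juncture_verts (flip E) (flip W) = juncture_verts W E"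
    by (simp add: juncture_verts_def)
  show "juncture (flip E) (flip W) = flip (juncture W E)"
    unfolding juncture_def v by (auto simp: flip_def fun_eq_iff)
  show "juncture_defined (flip E) (flip W)"
    using d unfolding juncture_defined_def v by (auto simp: D_graph_flip)
qed

locale juncture_pair =
  fixes W E :: "('v, 'e) pre_digraph"
  assumes defined: "juncture_defined W E"
begin

abbreviation "J \<equiv> juncture W E"
abbreviation "K \<equiv> juncture_verts W E"

text \<open>Interpreting the locale at the reversed pair turns statements about \<open>W\<close>
  into statements about \<open>E\<close>.\<close>

lemma flipped: "juncture_pair (flip E) (flip W)"
  by (rule juncture_pair.intro) (rule flip_juncture(2)[OF defined])

lemma W: "D_graph W" and E: "D_graph E"
  and common: "arcs W \<inter> arcs E \<noteq> {}"
  and Int_verts: "verts W \<inter> verts E = K"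
  using defined by (auto simp: juncture_defined_def)

lemma common_arc:
  assumes "a \<in> arcs W" "a \<in> arcs E"
  shows "head W a = tail E a" "a \<in> side_edges East W" "a \<in> side_edges West E" "head W a \<in> K"
  using defined assms by (auto simp: juncture_defined_def juncture_verts_def)

lemma J_sel [simp]:
  "verts J = verts W \<union> verts E - K" "arcs J = arcs W \<union> arcs E"
  "tail J a = (if a \<in> arcs W then tail W a else tail E a)"
  "head J a = (if a \<in> arcs E then head E a else head W a)"
  by (auto simp: juncture_def)

lemma K_flip: "juncture_verts (flip E) (flip W) = K"
  using flip_juncture(2)[OF defined] Int_verts unfolding juncture_defined_def by auto

lemma K_elim:
  assumes "v \<in> K"
  obtains a where "a \<in> arcs W" "a \<in> arcs E" "head W a = v" "tail E a = v"
  using assms common_arc(1) by (auto simp: juncture_verts_def)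

lemma K_side: "K \<subseteq> side_verts East W" "K \<subseteq> side_verts West E"
proof -
  have "v \<in> side_verts East W \<and> v \<in> side_verts West E" if "v \<in> K" for v
  proof -
    from K_elim[OF that] obtain a where a: "a \<in> arcs W" "a \<in> arcs E" "head W a = v" "tail E a = v" .
    then show ?thesis using common_arc(2,3)[OF a(1,2)] by (simp add: side_edges_def)
  qed
  then show "K \<subseteq> side_verts East W" "K \<subseteq> side_verts West E" by auto
qed

lemma tail_W: "a \<in> arcs W \<Longrightarrow> tail W a \<in> verts W - K"
  using tail_not_East[OF D_graph_wf[OF W], of a] K_side(1) wf_digraph.tail_in_verts[OF D_graph_wf[OF W]]
  by auto

text \<open>A vertex of \<open>K\<close> is an East vertex of \<open>W\<close>, so the common edge
  that produced it is the only edge entering it.\<close>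

lemma head_W_in_K: "a \<in> arcs W \<Longrightarrow> head W a \<in> K \<Longrightarrow> a \<in> arcs E"
  by (metis K_elim East_edge_unique[OF W] common_arc(2))

lemma head_W: "a \<in> arcs W \<Longrightarrow> a \<notin> arcs E \<Longrightarrow> head W a \<in> verts W - K"
  using head_W_in_K wf_digraph.head_in_verts[OF D_graph_wf[OF W]] by blast

lemma head_E: "a \<in> arcs E \<Longrightarrow> head E a \<in> verts E - K"
  and tail_E: "a \<in> arcs E \<Longrightarrow> a \<notin> arcs W \<Longrightarrow> tail E a \<in> verts E - K"
proof -
  note * = juncture_pair.tail_W[OF flipped, unfolded K_flip] juncture_pair.head_W[OF flipped, unfolded K_flip]
  show "a \<in> arcs E \<Longrightarrow> head E a \<in> verts E - K" using *(1)[of a] by simp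
  show "a \<in> arcs E \<Longrightarrow> a \<notin> arcs W \<Longrightarrow> tail E a \<in> verts E - K" using *(2)[of a] by simp
qed

lemma arcs_J_W:
  assumes "v \<in> verts W - K"
  shows "in_arcs J v = in_arcs W v" "out_arcs J v = out_arcs W v"
proof -
  have v: "v \<notin> verts E" using assms Int_verts by blast
  show "in_arcs J v = in_arcs W v"
    using v assms head_E common_arc(4) by (auto split: if_splits)
  show "out_arcs J v = out_arcs W v"
    using v tail_E by (auto split: if_splits)
qed

lemma arcs_J_E:
  assumes "v \<in> verts E - K"
  shows "in_arcs J v = in_arcs E v" "out_arcs J v = out_arcs E v"
proof -
  have "v \<in> verts (flip E) - juncture_verts (flip E) (flip W)" using assms by (simp add: K_flip)
  from juncture_pair.arcs_J_W[OF flipped this]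
  show "in_arcs J v = in_arcs E v" "out_arcs J v = out_arcs E v"
    unfolding flip_juncture(1)[OF defined] by simp_all
qed

lemma side_verts_J:
  "side_verts West J = side_verts West W \<union> (side_verts West E - K)"
  "side_verts East J = (side_verts East W - K) \<union> side_verts East E"
proof -
  have "v \<in> side_verts X J \<longleftrightarrow> v \<in> side_verts X W \<and> v \<notin> K" if "v \<in> verts W - K" for v X
    using that arcs_J_W[OF that] by (cases X) (auto simp: in_side_verts_West in_side_verts_East)
  moreover have "v \<in> side_verts X J \<longleftrightarrow> v \<in> side_verts X E \<and> v \<notin> K" if "v \<in> verts E - K" for v X
    using that arcs_J_E[OF that] by (cases X) (auto simp: in_side_verts_West in_side_verts_East)
  moreover have "side_verts X D \<subseteq> verts D" for X and D :: "('v, 'e) pre_digraph"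
    by (auto simp: side_verts_def)
  ultimately have *: "side_verts X J = (side_verts X W - K) \<union> (side_verts X E - K)" for X
    using Int_verts J_sel(1) by blast
  have "side_verts West W \<inter> K = {}" "side_verts East E \<inter> K = {}"
    using not_West_and_East[OF W] not_West_and_East[OF E] K_side by auto
  then show "side_verts West J = side_verts West W \<union> (side_verts West E - K)"
    "side_verts East J = (side_verts East W - K) \<union> side_verts East E"
    using *[of West] *[of East] by auto
qed

lemma inner_verts_J: "inner_verts J = inner_verts W \<union> inner_verts E"
  using K_side Int_verts not_West_and_East[OF W] not_West_and_East[OF E]
  unfolding inner_verts_def side_verts_J J_sel(1)
  by (auto simp: in_side_verts_West in_side_verts_East)

lemma fin_J: "fin_digraph J"
proof -
  interpret W: fin_digraph W by (rule D_graph_fin[OF W])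
  interpret E: fin_digraph E by (rule D_graph_fin[OF E])
  show ?thesis
    by unfold_locales (use tail_W tail_E head_W head_E in \<open>auto split: if_splits\<close>)
qed

lemma ranked_J: "ranked J"
proof -
  obtain r1 r2 :: "'v \<Rightarrow> nat" where r1: "\<And>a. a \<in> arcs W \<Longrightarrow> r1 (tail W a) < r1 (head W a)"
    and r2: "\<And>a. a \<in> arcs E \<Longrightarrow> r2 (tail E a) < r2 (head E a)"
    using W E by (auto simp: D_graph_iff_ranked ranked_def)
  interpret W: fin_digraph W by (rule D_graph_fin[OF W])
  \<comment> \<open>\<open>m\<close> exceeds all ranks in \<open>W\<close>, so adding it to the
    ranks in \<open>E\<close> puts the rest of \<open>E\<close> above \<open>W\<close>. This
    suffices since edges between the two sides of the juncture all lead from \<open>W\<close> to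
    \<open>E\<close>.\<close>
  define m where "m = Suc (Max (r1 ` verts W))"
  have m: "r1 v < m" if "v \<in> verts W" for v using that by (simp add: m_def less_Suc_eq_le)
  define r where "r v = (if v \<in> verts W then r1 v else m + r2 v)" for v
  have notW: "v \<notin> verts W" if "v \<in> verts E - K" for v using that Int_verts by blast
  have "r (tail J a) < r (head J a)" if a: "a \<in> arcs J" for a
  proof (cases "a \<in> arcs W")
    case aW: True
    then have t: "tail W a \<in> verts W" by simp
    show ?thesis
    proof (cases "a \<in> arcs E")
      case True
      then show ?thesis using aW t m[OF t] notW[OF head_E[OF True]] by (simp add: r_def)
    next
      case False
      then show ?thesis using aW t r1[OF aW] by (simp add: r_def)
    qed
  next
    case False
    then have "a \<in> arcs E" using a by simp
    then show ?thesis using False notW[OF head_E] notW[OF tail_E] r2 by (simp add: r_def)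
  qed
  then show ?thesis unfolding ranked_def by blast
qed

lemma functional_J: "WE_functional J"
  unfolding WE_functional_iff
proof (intro conjI ballI)
  have sub: "side_verts X D \<subseteq> verts D" for X and D :: "('v, 'e) pre_digraph"
    by (auto simp: side_verts_def)
  fix v a b
  show "a = b" if v: "v \<in> side_verts West J" and ab: "a \<in> out_arcs J v" "b \<in> out_arcs J v"
  proof -
    have "v \<in> verts J" using v sub by blast
    then consider "v \<in> verts W - K" | "v \<in> verts E - K" by auto
    then show ?thesis
    proof cases
      case 1
      then have "v \<in> side_verts West W" using v arcs_J_W[OF 1] by (simp add: in_side_verts_West)
      from West_vert_arc[OF W this] obtain c where "out_arcs W v = {c}" .
      then show ?thesis using ab arcs_J_W[OF 1] by auto
    next
      case 2
      then have "v \<in> side_verts West E" using v arcs_J_E[OF 2] by (simp add: in_side_verts_West)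
      from West_vert_arc[OF E this] obtain c where "out_arcs E v = {c}" .
      then show ?thesis using ab arcs_J_E[OF 2] by auto
    qed
  qed
  show "a = b" if v: "v \<in> side_verts East J" and ab: "a \<in> in_arcs J v" "b \<in> in_arcs J v"
  proof -
    have "v \<in> verts J" using v sub by blast
    then consider "v \<in> verts W - K" | "v \<in> verts E - K" by auto
    then show ?thesis
    proof cases
      case 1
      then have "v \<in> side_verts East W" using v arcs_J_W[OF 1] by (simp add: in_side_verts_East)
      from East_vert_arc[OF W this] obtain c where "in_arcs W v = {c}" .
      then show ?thesis using ab arcs_J_W[OF 1] by auto
    next
      case 2
      then have "v \<in> side_verts East E" using v arcs_J_E[OF 2] by (simp add: in_side_verts_East)
      from East_vert_arc[OF E this] obtain c where "in_arcs E v = {c}" .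
      then show ?thesis using ab arcs_J_E[OF 2] by auto
    qed
  qed
qed

text \<open>
  Deleting \<open>K\<close> does not disconnect: \<open>h\<close> moves each vertex of \<open>K\<close> along its edge into \<open>E\<close>, fixes the
  other vertices of \<open>W\<close>, and is a homomorphism from \<open>W\<close> to \<open>J\<close>.
\<close>

lemma connected_W:
  assumes u: "u \<in> verts W - K" and v: "v \<in> verts W - K"
  shows "(u, v) \<in> (adj J)\<^sup>*"
proof -
  define h where "h x = (if x \<in> K then head E (THE a. a \<in> arcs W \<and> head W a = x) else x)" for x
  have h_head: "h (head W a) = head J a" if a: "a \<in> arcs W" for a
  proof (cases "a \<in> arcs E")
    case True
    have "(THE b. b \<in> arcs W \<and> head W b = head W a) = a"
      using a East_edge_unique[OF W common_arc(2)[OF a True]] by blast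
    then show ?thesis using common_arc(4)[OF a True] True by (simp add: h_def)
  next
    case False
    then show ?thesis using head_W[OF a] by (simp add: h_def)
  qed
  have h_tail: "h (tail W a) = tail J a" if "a \<in> arcs W" for a
    using tail_W[OF that] that by (simp add: h_def)
  have hom: "(h x, h y) \<in> (adj J)\<^sup>*" if xy: "joins W a x y" for a x y
  proof -
    have "joins J a (h x) (h y)"
      using xy h_head[of a] h_tail[of a] by (auto simp: joins_def simp del: J_sel(3,4))
    then show ?thesis by (auto simp: adj_def)
  qed
  have "(u, v) \<in> (adj W)\<^sup>*" using D_graph_adj[OF W] u v by blast
  from adj_rtrancl_map[of u v W h J, OF this hom] have "(h u, h v) \<in> (adj J)\<^sup>*" .
  then show ?thesis using u v by (simp add: h_def)
qed

lemma connected_E: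
  assumes "u \<in> verts E - K" "v \<in> verts E - K"
  shows "(u, v) \<in> (adj J)\<^sup>*"
proof -
  show ?thesis
    using juncture_pair.connected_W[OF flipped, unfolded K_flip flip_juncture(1)[OF defined]] assms
    by (simp add: adj_def)
qed

lemma connected_J: "weakly_connected J"
proof -
  have wf: "wf_digraph J" using fin_J by (simp add: fin_digraph_def)
  obtain a where a: "a \<in> arcs W" "a \<in> arcs E" using common by blast
  then have "joins J a (tail W a) (head E a)" by (simp add: joins_def)
  then have e: "(tail W a, head E a) \<in> (adj J)\<^sup>*" by (auto simp: adj_def)
  have WE: "(u, v) \<in> (adj J)\<^sup>*" if "u \<in> verts W - K" "v \<in> verts E - K" for u v
    using connected_W[OF that(1) tail_W[OF a(1)]] e connected_E[OF head_E[OF a(2)] that(2)]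
    by (meson rtrancl_trans)
  have "(u, v) \<in> (adj J)\<^sup>*" if uv: "u \<in> verts J" "v \<in> verts J" for u v
  proof -
    have "u \<in> verts W - K \<or> u \<in> verts E - K" "v \<in> verts W - K \<or> v \<in> verts E - K"
      using uv by auto
    then show ?thesis using connected_W connected_E WE adj_rtrancl_sym[of v u] by blast
  qed
  then show ?thesis using weakly_connected_iff_adj[OF wf] by blast
qed

lemma D_graph_J: "D_graph J"
proof -
  have "inner_verts J \<noteq> {}" using W inner_verts_J by (simp add: D_graph_def)
  then show ?thesis using fin_J ranked_J functional_J connected_J by (simp add: D_graph_iff_ranked)
qed

lemma list_West_J:
  assumes LW: "list_of_side West W LW" and E: "list_of_side West E (\<Phi> @ \<Xi> @ \<Psi>)" and K: "K = set \<Xi>"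
  shows "list_of_side West J (\<Phi> @ LW @ \<Psi>)"
proof -
  have d: "distinct (\<Phi> @ \<Xi> @ \<Psi>)" and s: "set (\<Phi> @ \<Xi> @ \<Psi>) = side_verts West E"
    using E by (auto simp: list_of_side_def)
  have *: "set \<Phi> \<union> set \<Psi> = side_verts West E - K" using d s K by auto
  have "side_verts West W \<subseteq> verts W" "side_verts West E \<subseteq> verts E" by (auto simp: side_verts_def)
  then have "(set \<Phi> \<union> set \<Psi>) \<inter> set LW = {}"
    using * LW Int_verts by (auto simp: list_of_side_def)
  then have "distinct (\<Phi> @ LW @ \<Psi>)" using d LW by (auto simp: list_of_side_def)
  moreover have "set (\<Phi> @ LW @ \<Psi>) = side_verts West J"
    using * LW by (auto simp: list_of_side_def side_verts_J)
  ultimately show ?thesis by (simp add: list_of_side_def)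
qed

lemma map_tail_J:
  "set S \<subseteq> arcs W \<Longrightarrow> map (tail J) S = map (tail W) S"
  "set S \<subseteq> arcs E \<Longrightarrow> set (map (tail E) S) \<inter> K = {} \<Longrightarrow> map (tail J) S = map (tail E) S"
proof -
  show "set S \<subseteq> arcs W \<Longrightarrow> map (tail J) S = map (tail W) S" by auto
  assume S: "set S \<subseteq> arcs E" "set (map (tail E) S) \<inter> K = {}"
  have "a \<notin> arcs W" if "a \<in> set S" for a
    using that S common_arc(1,4)[of a] by auto
  then show "map (tail J) S = map (tail E) S" by auto
qed

end

section \<open>Constructions are swept by runs\<close>

text \<open>This is what remains of a construction once its tree is forgotten. The lists at the root
  are retained as the tails of the first front and the heads of the last one, because the next
  juncture glues fronts along them.\<close>

definition swept :: "('v, 'e) pre_digraph \<Rightarrow> 'v list \<Rightarrow> 'v list \<Rightarrow> bool" where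
  "swept D LW LE \<longleftrightarrow> D_graph D \<and> list_of_side West D LW \<and> list_of_side East D LE \<and>
     (\<exists>xs S T. run D S xs T \<and> distinct xs \<and> set xs = inner_verts D \<and>
        set S \<subseteq> arcs D \<and> set T \<subseteq> arcs D \<and> map (tail D) S = LW \<and> map (head D) T = LE)"

lemma West_edges_of_list:
  assumes D: "D_graph D" and L: "list_of_side West D (map (tail D) S)" and S: "set S \<subseteq> arcs D"
  shows "set S = side_edges West D" "distinct S"
proof -
  have L': "distinct (map (tail D) S)" "tail D ` set S = side_verts West D"
    using L by (auto simp: list_of_side_def)
  show "distinct S" using L'(1) by (simp add: distinct_map)
  have "a \<in> set S" if a: "a \<in> side_edges West D" for a
  proof -
    have "tail D a \<in> tail D ` set S" using a L'(2) by (simp add: side_edges_def)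
    then obtain b where b: "b \<in> set S" "tail D b = tail D a" by force
    then have "b = a" using West_edge_unique[OF D a] S by blast
    then show ?thesis using b by simp
  qed
  moreover have "a \<in> side_edges West D" if "a \<in> set S" for a
    using that S L'(2) by (auto simp: side_edges_def)
  ultimately show "set S = side_edges West D" by blast
qed

lemma list_of_side_flip [simp]: "list_of_side X (flip D) L = list_of_side (opp X) D L"
  by (simp add: list_of_side_def)

lemma East_edges_of_list:
  assumes D: "D_graph D" and L: "list_of_side East D (map (head D) T)" and T: "set T \<subseteq> arcs D"
  shows "set T = side_edges East D" "distinct T"
  using West_edges_of_list[of "flip D" T] assms by (simp_all add: D_graph_flip)

text \<open>By functionality an edge from a West vertex to an East vertex would, with its two ends,
  be closed under adjacency. Connectedness would then leave no room for an inner vertex.\<close>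

lemma no_West_East_edge:
  assumes D: "D_graph D" and a: "a \<in> side_edges West D"
  shows "head D a \<in> inner_verts D"
proof (rule ccontr)
  assume "head D a \<notin> inner_verts D"
  have aD: "a \<in> arcs D" using a by (simp add: side_edges_def)
  have "head D a \<in> side_verts East D"
    using head_not_West[OF D_graph_wf[OF D] aD] \<open>head D a \<notin> inner_verts D\<close> by simp
  then have aE: "a \<in> side_edges East D" using aD by (simp add: side_edges_def)
  have ends: "tail D a \<in> verts D" "head D a \<in> verts D"
    using D_graph_wf[OF D] aD by (simp_all add: wf_digraph_def)
  obtain x where x: "x \<in> inner_verts D" using D by (auto simp: D_graph_def)
  then have "x \<in> verts D" by (simp add: inner_verts_def)
  then have path: "(tail D a, x) \<in> (adj D)\<^sup>*" using D_graph_adj[OF D ends(1)] by simp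
  have closed: "tail D b \<in> {tail D a, head D a} \<longleftrightarrow> head D b \<in> {tail D a, head D a}"
    if b: "b \<in> arcs D" for b
  proof (cases "b = a")
    case False
    have "tail D b \<noteq> tail D a" using West_edge_unique[OF D a b] False by blast
    moreover have "head D b \<noteq> head D a" using East_edge_unique[OF D aE b] False by blast
    moreover have "tail D b \<noteq> head D a"
      using tail_not_East[OF D_graph_wf[OF D] b] \<open>head D a \<in> side_verts East D\<close> by auto
    moreover have "head D b \<noteq> tail D a"
      using head_not_West[OF D_graph_wf[OF D] b] a by (auto simp: side_edges_def)
    ultimately show ?thesis by simp
  qed simp
  have "x \<in> {tail D a, head D a}" by (rule adj_rtrancl_closed[OF path _ closed]) simp_all
  then show False
    using x a \<open>head D a \<in> side_verts East D\<close> by (auto simp: inner_verts_def side_edges_def)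
qed

lemma exists_edge_list:
  assumes "D_graph D" "list_of_side West D L"
  shows "\<exists>S. set S \<subseteq> arcs D \<and> map (tail D) S = L"
proof -
  have "\<exists>a. a \<in> arcs D \<and> tail D a = v" if "v \<in> set L" for v
  proof -
    have "v \<in> side_verts West D" using that assms(2) by (simp add: list_of_side_def)
    from West_vert_arc[OF assms(1) this] obtain a where "a \<in> arcs D" "tail D a = v" .
    then show ?thesis by blast
  qed
  then obtain f where f: "\<And>v. v \<in> set L \<Longrightarrow> f v \<in> arcs D \<and> tail D (f v) = v" by metis
  have "set (map f L) \<subseteq> arcs D" "map (tail D) (map f L) = L" using f by (auto intro: map_idI)
  then show ?thesis by blast
qed

lemma basic_side_edges:
  assumes D: "D_graph D" and x: "inner_verts D = {x}"
  shows "side_edges West D = in_arcs D x"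
proof -
  have "tail D a \<in> side_verts West D" if a: "a \<in> arcs D" "head D a = x" for a
    using tail_not_East[OF D_graph_wf[OF D] a(1)] D_graph_no_loop[OF D a(1)] a(2) x by auto
  then show ?thesis using no_West_East_edge[OF D] x by (auto simp: side_edges_def)
qed

text \<open>All West edges enter the only inner vertex and all East edges leave it, so one step
  leads from any listing of the former to any listing of the latter. This is why a leaf may carry
  arbitrary lists.\<close>

lemma swept_basic:
  assumes b: "basic_D_graph D" and LW: "list_of_side West D LW" and LE: "list_of_side East D LE"
  shows "swept D LW LE"
proof -
  obtain x where D: "D_graph D" and x: "inner_verts D = {x}" using b by (auto simp: basic_D_graph_def)
  have flip: "D_graph (flip D)" using D by (simp add: D_graph_flip)
  obtain S where S: "set S \<subseteq> arcs D" "map (tail D) S = LW" using exists_edge_list[OF D LW] by blast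
  obtain T where T: "set T \<subseteq> arcs D" "map (head D) T = LE"
    using exists_edge_list[OF flip, of LE] LE by auto
  have S': "set S = in_arcs D x" "distinct S"
    using West_edges_of_list[OF D, of S] S LW basic_side_edges[OF D x] by simp_all
  have T': "set T = out_arcs D x" "distinct T"
    using East_edges_of_list[OF D, of T] T LE basic_side_edges[OF flip, of x] x by simp_all
  have "run D ([] @ S @ []) [x] T"
    by (rule run_Cons[OF S' T']) (simp add: run_Nil)
  then have "run D S [x] T" by simp
  then show ?thesis unfolding swept_def using D LW LE S T x by fastforce
qed

lemma distinct_infix_unique:
  assumes "distinct (A @ \<Xi> @ B)" "A @ \<Xi> @ B = A' @ \<Xi> @ B'" "\<Xi> \<noteq> []"
  shows "A = A'" "B = B'"
proof -
  obtain x xs where \<Xi>: "\<Xi> = x # xs" using assms(3) by (cases \<Xi>) auto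
  have "x \<notin> set A" "x \<notin> set (xs @ B)" using assms(1) \<Xi> by auto
  then have "A = A' \<and> xs @ B = xs @ B'"
    using assms(2) unfolding \<Xi> by (simp add: append_Cons_eq_iff)
  then show "A = A'" "B = B'" by auto
qed

text \<open>The four forms of compatibility amount to one condition: on either side of \<Xi> at most
  one of the two lists continues. The position of \<Xi> in a distinct list is unique, which
  identifies the given splittings with those hidden in the definition.\<close>

lemma compatible_lists_via_cases:
  assumes c: "compatible_lists_via \<Xi> (\<Phi>\<^sub>E @ \<Xi> @ \<Psi>\<^sub>E) (\<Phi>\<^sub>W @ \<Xi> @ \<Psi>\<^sub>W)"
    and d: "distinct (\<Phi>\<^sub>E @ \<Xi> @ \<Psi>\<^sub>E)" "distinct (\<Phi>\<^sub>W @ \<Xi> @ \<Psi>\<^sub>W)"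
  shows "\<Phi>\<^sub>E = [] \<or> \<Phi>\<^sub>W = []" "\<Psi>\<^sub>E = [] \<or> \<Psi>\<^sub>W = []"
    "set (\<Phi>\<^sub>E @ \<Xi> @ \<Psi>\<^sub>E) \<inter> set (\<Phi>\<^sub>W @ \<Xi> @ \<Psi>\<^sub>W) = set \<Xi>"
proof -
  \<comment> \<open>With the empty lists written out, all four forms have the shape that
    \<open>distinct_infix_unique\<close> expects.\<close>
  obtain \<Phi> \<Psi> where n: "\<Xi> \<noteq> []" and p: "distinct (\<Phi> @ \<Xi> @ \<Psi>)"
    and cs: "\<Phi>\<^sub>E @ \<Xi> @ \<Psi>\<^sub>E = \<Phi> @ \<Xi> @ [] \<and> \<Phi>\<^sub>W @ \<Xi> @ \<Psi>\<^sub>W = [] @ \<Xi> @ \<Psi> \<or>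
      \<Phi>\<^sub>W @ \<Xi> @ \<Psi>\<^sub>W = \<Phi> @ \<Xi> @ [] \<and> \<Phi>\<^sub>E @ \<Xi> @ \<Psi>\<^sub>E = [] @ \<Xi> @ \<Psi> \<or>
      \<Phi>\<^sub>E @ \<Xi> @ \<Psi>\<^sub>E = \<Phi> @ \<Xi> @ \<Psi> \<and> \<Phi>\<^sub>W @ \<Xi> @ \<Psi>\<^sub>W = [] @ \<Xi> @ [] \<or>
      \<Phi>\<^sub>W @ \<Xi> @ \<Psi>\<^sub>W = \<Phi> @ \<Xi> @ \<Psi> \<and> \<Phi>\<^sub>E @ \<Xi> @ \<Psi>\<^sub>E = [] @ \<Xi> @ []"
    using c unfolding compatible_lists_via_def append_Nil append_Nil2 by blast
  note u = distinct_infix_unique[OF d(1) _ n] distinct_infix_unique[OF d(2) _ n]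
  have "\<Phi>\<^sub>E = \<Phi> \<and> \<Psi>\<^sub>E = [] \<and> \<Phi>\<^sub>W = [] \<and> \<Psi>\<^sub>W = \<Psi> \<or> \<Phi>\<^sub>W = \<Phi> \<and> \<Psi>\<^sub>W = [] \<and> \<Phi>\<^sub>E = [] \<and> \<Psi>\<^sub>E = \<Psi> \<or>
      \<Phi>\<^sub>E = \<Phi> \<and> \<Psi>\<^sub>E = \<Psi> \<and> \<Phi>\<^sub>W = [] \<and> \<Psi>\<^sub>W = [] \<or> \<Phi>\<^sub>W = \<Phi> \<and> \<Psi>\<^sub>W = \<Psi> \<and> \<Phi>\<^sub>E = [] \<and> \<Psi>\<^sub>E = []"
    using cs by (elim disjE conjE) (frule u(1), frule u(2), frule u(3), frule u(4), simp)+
  then show "\<Phi>\<^sub>E = [] \<or> \<Phi>\<^sub>W = []" "\<Psi>\<^sub>E = [] \<or> \<Psi>\<^sub>W = []"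
    "set (\<Phi>\<^sub>E @ \<Xi> @ \<Psi>\<^sub>E) \<inter> set (\<Phi>\<^sub>W @ \<Xi> @ \<Psi>\<^sub>W) = set \<Xi>"
    using p by auto
qed

lemma map_eq_append3:
  assumes "map f xs = A @ B @ C"
  obtains a b c where "xs = a @ b @ c" "map f a = A" "map f b = B" "map f c = C"
proof -
  obtain a d where "xs = a @ d" "map f a = A" "map f d = B @ C"
    using assms by (metis map_eq_append_conv)
  moreover obtain b c where "d = b @ c" "map f b = B" "map f c = C"
    using calculation(3) by (metis map_eq_append_conv)
  ultimately show ?thesis using that by simp
qed

text \<open>The western graph is swept between \<open>s\<phi>\<close> and \<open>s\<psi>\<close>,
  the eastern edges waiting at the sides; then the eastern graph is swept between
  \<open>t\<phi>\<close> and \<open>t\<psi>\<close>, the western edges already finished.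
  Compatibility is what makes the two sweeps meet in the same front.\<close>

lemma swept_juncture:
  assumes sweptW: "swept D\<^sub>W LW\<^sub>W (\<Phi>\<^sub>E @ \<Xi> @ \<Psi>\<^sub>E)" and sweptE: "swept D\<^sub>E (\<Phi>\<^sub>W @ \<Xi> @ \<Psi>\<^sub>W) LE\<^sub>E"
    and def: "juncture_defined D\<^sub>W D\<^sub>E"
    and comp: "compatible_lists_via \<Xi> (\<Phi>\<^sub>E @ \<Xi> @ \<Psi>\<^sub>E) (\<Phi>\<^sub>W @ \<Xi> @ \<Psi>\<^sub>W)"
  shows "swept (juncture D\<^sub>W D\<^sub>E) (\<Phi>\<^sub>W @ LW\<^sub>W @ \<Psi>\<^sub>W) (\<Phi>\<^sub>E @ LE\<^sub>E @ \<Psi>\<^sub>E)"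
proof -
  interpret juncture_pair D\<^sub>W D\<^sub>E by (rule juncture_pair.intro[OF def])
  interpret flipped: juncture_pair "flip D\<^sub>E" "flip D\<^sub>W" by (rule flipped)
  note J = flip_juncture(1)[OF def]
  obtain xs S T1 where LW: "list_of_side West D\<^sub>W LW\<^sub>W" and LE: "list_of_side East D\<^sub>W (\<Phi>\<^sub>E @ \<Xi> @ \<Psi>\<^sub>E)"
    and r: "run D\<^sub>W S xs T1" "distinct xs" "set xs = inner_verts D\<^sub>W"
    and S: "set S \<subseteq> arcs D\<^sub>W" "map (tail D\<^sub>W) S = LW\<^sub>W"
    and T1: "set T1 \<subseteq> arcs D\<^sub>W" "map (head D\<^sub>W) T1 = \<Phi>\<^sub>E @ \<Xi> @ \<Psi>\<^sub>E"
    using sweptW unfolding swept_def by blast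
  obtain ys S1 T where LW': "list_of_side West D\<^sub>E (\<Phi>\<^sub>W @ \<Xi> @ \<Psi>\<^sub>W)" and LE': "list_of_side East D\<^sub>E LE\<^sub>E"
    and r': "run D\<^sub>E S1 ys T" "distinct ys" "set ys = inner_verts D\<^sub>E"
    and S1: "set S1 \<subseteq> arcs D\<^sub>E" "map (tail D\<^sub>E) S1 = \<Phi>\<^sub>W @ \<Xi> @ \<Psi>\<^sub>W"
    and T: "set T \<subseteq> arcs D\<^sub>E" "map (head D\<^sub>E) T = LE\<^sub>E"
    using sweptE unfolding swept_def by blast
  obtain t\<phi> t\<xi> t\<psi> where T1': "T1 = t\<phi> @ t\<xi> @ t\<psi>"
    and t: "map (head D\<^sub>W) t\<phi> = \<Phi>\<^sub>E" "map (head D\<^sub>W) t\<xi> = \<Xi>" "map (head D\<^sub>W) t\<psi> = \<Psi>\<^sub>E"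
    using map_eq_append3[OF T1(2)] .
  obtain s\<phi> s\<xi> s\<psi> where S1': "S1 = s\<phi> @ s\<xi> @ s\<psi>"
    and s: "map (tail D\<^sub>E) s\<phi> = \<Phi>\<^sub>W" "map (tail D\<^sub>E) s\<xi> = \<Xi>" "map (tail D\<^sub>E) s\<psi> = \<Psi>\<^sub>W"
    using map_eq_append3[OF S1(2)] .
  have dE: "distinct (\<Phi>\<^sub>E @ \<Xi> @ \<Psi>\<^sub>E)" and dW: "distinct (\<Phi>\<^sub>W @ \<Xi> @ \<Psi>\<^sub>W)"
    using LE LW' by (simp_all add: list_of_side_def)
  note cases = compatible_lists_via_cases[OF comp dE dW]
  have K\<Xi>: "K = set \<Xi>"
  proof
    show "K \<subseteq> set \<Xi>" using K_side LE LW' cases(3) by (simp add: list_of_side_def) blast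
    have "side_verts East D\<^sub>W \<subseteq> verts D\<^sub>W" "side_verts West D\<^sub>E \<subseteq> verts D\<^sub>E"
      by (auto simp: side_verts_def)
    moreover have "set \<Xi> \<subseteq> side_verts East D\<^sub>W" "set \<Xi> \<subseteq> side_verts West D\<^sub>E"
      using LE LW' unfolding list_of_side_def by fastforce+
    ultimately show "set \<Xi> \<subseteq> K" using Int_verts by blast
  qed
  have t\<xi>E: "a \<in> arcs D\<^sub>E \<and> tail D\<^sub>E a = head D\<^sub>W a" if a: "a \<in> set t\<xi>" for a
  proof -
    have aW: "a \<in> arcs D\<^sub>W" using a T1(1) T1' by auto
    moreover have "head D\<^sub>W a \<in> set \<Xi>" using a t(2) by auto
    ultimately have "a \<in> arcs D\<^sub>E" using head_W_in_K K\<Xi> by blast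
    then show ?thesis using common_arc(1)[OF aW] by simp
  qed
  have "map (tail D\<^sub>E) t\<xi> = map (head D\<^sub>W) t\<xi>" using t\<xi>E by simp
  then have eq: "map (tail D\<^sub>E) t\<xi> = map (tail D\<^sub>E) s\<xi>" using t(2) s(2) by simp
  have "set t\<xi> \<union> set s\<xi> \<subseteq> side_edges West D\<^sub>E"
  proof -
    have "a \<in> side_edges West D\<^sub>E" if "a \<in> arcs D\<^sub>E" "tail D\<^sub>E a \<in> set \<Xi>" for a
      using that LW' by (auto simp: list_of_side_def side_edges_def)
    moreover have "tail D\<^sub>E a \<in> set \<Xi>" if "a \<in> set t\<xi> \<union> set s\<xi>" for a
      using that eq s(2) by (metis UnE image_eqI list.set_map)
    moreover have "set s\<xi> \<subseteq> arcs D\<^sub>E" using S1(1) S1' by auto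
    ultimately show ?thesis using t\<xi>E by blast
  qed
  \<comment> \<open>The lists of a construction agree in vertices only. Injectivity of the tail on
    West edges lifts this to the edges, so that the fronts themselves contain the same
    block.\<close>
  moreover have "inj_on (tail D\<^sub>E) (side_edges West D\<^sub>E)"
    using inj_on_head_East[of "flip D\<^sub>E"] E by (simp add: swept_def D_graph_flip)
  ultimately have \<xi>: "t\<xi> = s\<xi>"
    using eq by (meson inj_on_map_eq_map inj_on_subset)
  have sub: "set t\<phi> \<subseteq> arcs D\<^sub>W" "set t\<psi> \<subseteq> arcs D\<^sub>W" "set s\<phi> \<subseteq> arcs D\<^sub>E" "set s\<psi> \<subseteq> arcs D\<^sub>E"
    using T1(1) T1' S1(1) S1' by auto
  have disj: "set \<Phi>\<^sub>W \<inter> K = {}" "set \<Psi>\<^sub>W \<inter> K = {}" "set \<Phi>\<^sub>E \<inter> K = {}" "set \<Psi>\<^sub>E \<inter> K = {}"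
    using dE dW K\<Xi> by auto
  have runW: "run J S xs T1"
  proof -
    have "x \<in> verts D\<^sub>W - K" if "x \<in> set xs" for x
      using that r(3) K_side(1) by (auto simp: inner_verts_def)
    then show ?thesis using run_map[OF r(1), of J id] arcs_J_W by simp
  qed
  have runE: "run J S1 ys T"
  proof -
    have "x \<in> verts D\<^sub>E - K" if "x \<in> set ys" for x
      using that r'(3) K_side(2) by (auto simp: inner_verts_def)
    then show ?thesis using run_map[OF r'(1), of J id] arcs_J_E by simp
  qed
  have "t\<phi> = [] \<or> s\<phi> = []" "t\<psi> = [] \<or> s\<psi> = []" using cases(1,2) t s by auto
  \<comment> \<open>On either side of the common block one of the two contexts is empty, so their
    order does not matter.\<close>
  then have swap: "s\<phi> @ T1 @ s\<psi> = t\<phi> @ S1 @ t\<psi>" unfolding T1' S1' \<xi> by auto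
  have "run J (s\<phi> @ S @ s\<psi>) (xs @ ys) (t\<phi> @ T @ t\<psi>)"
    using run_append[OF run_context[OF runW, of s\<phi> s\<psi>]] run_context[OF runE, of t\<phi> t\<psi>] swap by simp
  moreover have "distinct (xs @ ys)"
  proof -
    have "v \<notin> inner_verts D\<^sub>E" if "v \<in> inner_verts D\<^sub>W" for v
    proof
      assume "v \<in> inner_verts D\<^sub>E"
      then have "v \<in> K" using that Int_verts by (auto simp: inner_verts_def)
      then show False using that K_side(1) by (auto simp: inner_verts_def)
    qed
    then show ?thesis using r(2,3) r'(2,3) by auto
  qed
  moreover have "set (xs @ ys) = inner_verts J" using r(3) r'(3) inner_verts_J by simp
  moreover have "set (s\<phi> @ S @ s\<psi>) \<subseteq> arcs J" "set (t\<phi> @ T @ t\<psi>) \<subseteq> arcs J"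
    using sub S(1) T(1) by auto
  moreover have "map (tail J) (s\<phi> @ S @ s\<psi>) = \<Phi>\<^sub>W @ LW\<^sub>W @ \<Psi>\<^sub>W"
    using map_tail_J(1)[OF S(1)] map_tail_J(2)[OF sub(3)] map_tail_J(2)[OF sub(4)] s S(2) disj
    by (simp del: J_sel)
  moreover have "map (head J) (t\<phi> @ T @ t\<psi>) = \<Phi>\<^sub>E @ LE\<^sub>E @ \<Psi>\<^sub>E"
  proof -
    note * = flipped.map_tail_J[unfolded J K_flip flip_simps]
    show ?thesis using *(1)[OF T(1)] *(2)[OF sub(1)] *(2)[OF sub(2)] t T(2) disj
      by (simp del: J_sel)
  qed
  moreover have "list_of_side West J (\<Phi>\<^sub>W @ LW\<^sub>W @ \<Psi>\<^sub>W)" by (rule list_West_J[OF LW LW' K\<Xi>])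
  moreover have "list_of_side East J (\<Phi>\<^sub>E @ LE\<^sub>E @ \<Psi>\<^sub>E)"
    using flipped.list_West_J[of LE\<^sub>E \<Phi>\<^sub>E \<Xi> \<Psi>\<^sub>E] LE LE' K_flip K\<Xi> unfolding J by simp
  ultimately show ?thesis using D_graph_J unfolding swept_def by blast
qed

lemma construction_swept:
  "construction T \<Longrightarrow> root T = (D, LW, LE) \<Longrightarrow> swept D LW LE"
proof (induction arbitrary: D LW LE rule: construction.induct)
  case (basic D0 LW0 LE0)
  then show ?case using swept_basic by simp
next
  case (junct K\<^sub>W K\<^sub>E D\<^sub>W LW\<^sub>W \<Phi>\<^sub>E \<Xi> \<Psi>\<^sub>E D\<^sub>E \<Phi>\<^sub>W \<Psi>\<^sub>W LE\<^sub>E)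
  have "D = juncture D\<^sub>W D\<^sub>E" "LW = \<Phi>\<^sub>W @ LW\<^sub>W @ \<Psi>\<^sub>W" "LE = \<Phi>\<^sub>E @ LE\<^sub>E @ \<Psi>\<^sub>E"
    using junct.prems by simp_all
  then show ?case
    using swept_juncture[OF junct.IH(1)[OF junct.hyps(3)] junct.IH(2)[OF junct.hyps(4)] junct.hyps(5,6)]
    by simp
qed

section \<open>Cutting through a cocycle\<close>

lemma adj_subgraph:
  assumes "subgraph H G"
  shows "adj H \<subseteq> adj G"
  using assms by (auto simp: adj_def joins_def subgraph_def compatible_def)

lemma induced_subgraph_arcs:
  assumes "induced_subgraph H G"
  shows "verts H \<subseteq> verts G" "arcs H = {a \<in> arcs G. tail G a \<in> verts H \<and> head G a \<in> verts H}"
    "tail H = tail G" "head H = head G" "wf_digraph H" "subgraph H G"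
  using assms by (auto simp: induced_subgraph_def subgraph_def compatible_def)

text \<open>If an edge left the component, adding its other end would give a larger connected
  induced subgraph, against maximality.\<close>

lemma weak_component_closed:
  assumes G: "wf_digraph G" and H: "H \<in> weak_components G" and a: "a \<in> arcs G"
  shows "tail G a \<in> verts H \<longleftrightarrow> head G a \<in> verts H"
proof -
  interpret wf_digraph G by fact
  have ind: "induced_subgraph H G" and conn: "weakly_connected H"
    and max: "\<And>H'. induced_subgraph H' G \<Longrightarrow> weakly_connected H' \<Longrightarrow> \<not> verts H \<subset> verts H'"
    using H by (auto simp: weak_components_def)
  note H' = induced_subgraph_arcs[OF ind]
  have "z \<in> verts H" if u: "u \<in> verts H" and j: "joins G a u z" for u z
  proof (rule ccontr)
    assume z: "z \<notin> verts H"
    have zG: "z \<in> verts G" using j by (auto simp: joins_def)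
    define Z where "Z = insert z (verts H)"
    have Z: "Z \<subseteq> verts G" using zG H'(1) by (auto simp: Z_def)
    have indZ: "induced_subgraph (G \<restriction> Z) G" using Z by (rule induced_induce)
    have "adj H \<subseteq> adj (G \<restriction> Z)"
      using H' by (auto simp: adj_def joins_def Z_def)
    then have "(adj H)\<^sup>* \<subseteq> (adj (G \<restriction> Z))\<^sup>*" by (rule rtrancl_mono)
    then have 1: "(u, y) \<in> (adj (G \<restriction> Z))\<^sup>*" if "y \<in> verts H" for y
      using that u conn weakly_connected_iff_adj[OF H'(5)] by blast
    have "joins (G \<restriction> Z) a u z" using j u by (auto simp: joins_def Z_def)
    then have "(u, z) \<in> (adj (G \<restriction> Z))\<^sup>*" by (auto simp: adj_def)
    with 1 have "(u, y) \<in> (adj (G \<restriction> Z))\<^sup>*" if "y \<in> Z" for y using that by (auto simp: Z_def)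
    then have "(y, y') \<in> (adj (G \<restriction> Z))\<^sup>*" if "y \<in> Z" "y' \<in> Z" for y y'
      using that by (meson adj_rtrancl_sym rtrancl_trans)
    moreover have "wf_digraph (G \<restriction> Z)" using induced_subgraph_arcs(5)[OF indZ] .
    ultimately have "weakly_connected (G \<restriction> Z)" by (simp add: weakly_connected_iff_adj)
    then have "\<not> verts H \<subset> verts (G \<restriction> Z)" by (rule max[OF indZ])
    then show False using z by (auto simp: Z_def)
  qed
  then show ?thesis using a unfolding joins_def by blast
qed

text \<open>The vertices reachable from \<open>v\<close> induce a component: paths from
  \<open>v\<close> stay inside this set, and a connected subgraph containing \<open>v\<close> cannot
  exceed it.\<close>

lemma weak_components_cover:
  assumes G: "wf_digraph G" and v: "v \<in> verts G"
  shows "\<exists>H \<in> weak_components G. v \<in> verts H"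
proof -
  interpret wf_digraph G by fact
  define Z where "Z = {y. (v, y) \<in> (adj G)\<^sup>*}"
  have "y \<in> verts G" if "(v, y) \<in> (adj G)\<^sup>*" for y
    using that v by induction (auto simp: adj_def joins_def)
  then have Z: "Z \<subseteq> verts G" by (auto simp: Z_def)
  have ind: "induced_subgraph (G \<restriction> Z) G" using Z by (rule induced_induce)
  have path: "(v, y) \<in> (adj (G \<restriction> Z))\<^sup>*" if "(v, y) \<in> (adj G)\<^sup>*" for y
    using that
  proof induction
    case (step y z)
    have "y \<in> Z" "z \<in> Z" using step.hyps by (auto simp: Z_def intro: rtrancl_into_rtrancl)
    then have "(y, z) \<in> adj (G \<restriction> Z)" using step.hyps(2) by (auto simp: adj_def joins_def)
    then show ?case using step.IH by (rule rtrancl_into_rtrancl[rotated])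
  qed simp
  have "(y, y') \<in> (adj (G \<restriction> Z))\<^sup>*" if "y \<in> Z" "y' \<in> Z" for y y'
  proof -
    have "(v, y) \<in> (adj (G \<restriction> Z))\<^sup>*" "(v, y') \<in> (adj (G \<restriction> Z))\<^sup>*"
      using that path by (auto simp: Z_def)
    then show ?thesis by (meson adj_rtrancl_sym rtrancl_trans)
  qed
  then have conn: "weakly_connected (G \<restriction> Z)"
    by (simp add: weakly_connected_iff_adj[OF induced_subgraph_arcs(5)[OF ind]])
  have "verts H' \<subseteq> Z" if H': "induced_subgraph H' G" "weakly_connected H'" and "Z \<subseteq> verts H'" for H'
  proof
    fix y assume y: "y \<in> verts H'"
    have "v \<in> verts H'" using \<open>Z \<subseteq> verts H'\<close> by (auto simp: Z_def)
    then have "(v, y) \<in> (adj H')\<^sup>*"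
      using y H'(2) weakly_connected_iff_adj[OF induced_subgraph_arcs(5)[OF H'(1)]] by blast
    then show "y \<in> Z"
      using rtrancl_mono[OF adj_subgraph[OF induced_subgraph_arcs(6)[OF H'(1)]]] by (auto simp: Z_def)
  qed
  moreover have "v \<in> Z" by (simp add: Z_def)
  ultimately have "G \<restriction> Z \<in> weak_components G"
    unfolding weak_components_def using ind conn by auto
  then show ?thesis using \<open>v \<in> Z\<close> by (metis induce_subgraph_verts)
qed

text \<open>A cocycle in terms of a partition of vertices and edges, without maximality of
  components. By \<open>arcs_D\<close> no edge leads from \<open>H2\<close> to \<open>H1\<close>.
  Reversal preserves the assumptions when \<open>H1\<close> and \<open>H2\<close> are exchanged, so
  each result below also yields its eastern form.\<close>

locale cut =
  fixes D :: "('v, 'e) pre_digraph" and C :: "'e set" and H1 H2 :: "('v, 'e) pre_digraph"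
  assumes D: "D_graph D"
    and C_nonempty: "C \<noteq> {}" and C_inner: "C \<subseteq> inner_edges D"
    and C_ends: "a \<in> C \<Longrightarrow> tail D a \<in> verts H1 \<and> head D a \<in> verts H2"
    and verts_D: "verts D = verts H1 \<union> verts H2" and verts_disjoint: "verts H1 \<inter> verts H2 = {}"
    and arcs_H1: "a \<in> arcs H1 \<longleftrightarrow> a \<in> arcs D \<and> tail D a \<in> verts H1 \<and> head D a \<in> verts H1"
    and arcs_H2: "a \<in> arcs H2 \<longleftrightarrow> a \<in> arcs D \<and> tail D a \<in> verts H2 \<and> head D a \<in> verts H2"
    and arcs_D: "arcs D = C \<union> arcs H1 \<union> arcs H2"
    and sel_H1: "tail H1 = tail D" "head H1 = head D"
    and sel_H2: "tail H2 = tail D" "head H2 = head D"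
    and connected_H1: "weakly_connected H1" and connected_H2: "weakly_connected H2"

lemma cocycle_imp_cut:
  assumes D: "D_graph D" and c: "cocycle D C H1 H2"
  shows "cut D C H1 H2"
proof -
  define G where "G = D\<lparr>arcs := arcs D - C\<rparr>"
  have G_sel: "verts G = verts D" "arcs G = arcs D - C" "tail G = tail D" "head G = head D"
    by (simp_all add: G_def)
  have wfD: "wf_digraph D" using D by (rule D_graph_wf)
  then have wf: "wf_digraph G" by (simp add: wf_digraph_def G_sel)
  have C: "C \<noteq> {}" "C \<subseteq> inner_edges D" "\<And>a. a \<in> C \<Longrightarrow> tail D a \<in> verts H1 \<and> head D a \<in> verts H2"
    and comps: "weak_components G = {H1, H2}" and neq: "H1 \<noteq> H2"
    using c by (auto simp: cocycle_def G_def)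
  have H: "H1 \<in> weak_components G" "H2 \<in> weak_components G" using comps by auto
  have ind: "induced_subgraph H1 G" "induced_subgraph H2 G"
    and conn: "weakly_connected H1" "weakly_connected H2"
    using H by (simp_all add: weak_components_def)
  note i1 = induced_subgraph_arcs[OF ind(1)] and i2 = induced_subgraph_arcs[OF ind(2)]
  have CD: "C \<subseteq> arcs D" using C(2) by (auto simp: inner_edges_def)
  have cover: "verts D = verts H1 \<union> verts H2"
    using weak_components_cover[OF wf] i1(1) i2(1) unfolding comps G_sel by blast
  \<comment> \<open>A component is connected and every other one is closed under adjacency, so one
    common vertex forces inclusion. Applied in both directions, it makes intersecting components
    equal, as they are induced.\<close>
  have meet: "verts H \<subseteq> verts H'"
    if "H \<in> weak_components G" "H' \<in> weak_components G" "z \<in> verts H" "z \<in> verts H'" for H H' z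
  proof
    fix y assume y: "y \<in> verts H"
    have iH: "induced_subgraph H G" "weakly_connected H" using that(1) by (simp_all add: weak_components_def)
    have "(z, y) \<in> (adj H)\<^sup>*"
      using iH(2) that(3) y weakly_connected_iff_adj[OF induced_subgraph_arcs(5)[OF iH(1)]] by blast
    then have "(z, y) \<in> (adj G)\<^sup>*"
      using rtrancl_mono[OF adj_subgraph[OF induced_subgraph_arcs(6)[OF iH(1)]]] by blast
    then show "y \<in> verts H'"
      by (rule adj_rtrancl_closed[OF _ that(4)]) (rule weak_component_closed[OF wf that(2)])
  qed
  have disj: "verts H1 \<inter> verts H2 = {}"
  proof (rule ccontr)
    assume "verts H1 \<inter> verts H2 \<noteq> {}"
    then have "verts H1 = verts H2" using meet[OF H] meet[OF H(2,1)] by blast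
    then have "arcs H1 = arcs H2" using i1(2) i2(2) by simp
    then have "H1 = H2" using i1(3,4) i2(3,4) \<open>verts H1 = verts H2\<close> by (intro pre_digraph.equality) simp_all
    then show False using neq by simp
  qed
  \<comment> \<open>The components are induced in the graph without \<open>C\<close>, yet they are
    induced in \<open>D\<close> as well, since an edge of \<open>C\<close> never has both ends in
    the same part.\<close>
  have arcs1: "a \<in> arcs H1 \<longleftrightarrow> a \<in> arcs D \<and> tail D a \<in> verts H1 \<and> head D a \<in> verts H1"
    and arcs2: "a \<in> arcs H2 \<longleftrightarrow> a \<in> arcs D \<and> tail D a \<in> verts H2 \<and> head D a \<in> verts H2" for a
    using i1(2) i2(2) C(3)[of a] disj by (auto simp: G_sel)
  have arcsD: "a \<in> C \<or> a \<in> arcs H1 \<or> a \<in> arcs H2" if a: "a \<in> arcs D" for a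
  proof (cases "a \<in> C")
    case False
    then have "a \<in> arcs G" using a by (simp add: G_sel)
    then have "tail D a \<in> verts H1 \<longleftrightarrow> head D a \<in> verts H1" "tail D a \<in> verts H2 \<longleftrightarrow> head D a \<in> verts H2"
      using weak_component_closed[OF wf H(1)] weak_component_closed[OF wf H(2)] by (simp_all add: G_sel)
    moreover have "tail D a \<in> verts H1 \<union> verts H2"
      using cover wfD a by (auto simp: wf_digraph_def)
    ultimately show ?thesis using a arcs1 arcs2 by blast
  qed simp
  show ?thesis
  proof (rule cut.intro)
    show "arcs D = C \<union> arcs H1 \<union> arcs H2" using arcsD CD arcs1 arcs2 by blast
    show "tail H1 = tail D" "head H1 = head D" "tail H2 = tail D" "head H2 = head D"
      using i1(3,4) i2(3,4) by (simp_all add: G_sel)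
  qed (use D C cover disj arcs1 arcs2 conn in blast)+
qed

section \<open>The western graph of a cut\<close>

context cut
begin

lemma flipped: "cut (flip D) C (flip H2) (flip H1)"
proof (rule cut.intro)
  show "D_graph (flip D)" using D by (simp add: D_graph_flip)
  show "arcs (flip D) = C \<union> arcs (flip H2) \<union> arcs (flip H1)" using arcs_D by auto
qed (use C_nonempty C_inner C_ends verts_D verts_disjoint arcs_H1 arcs_H2 sel_H1 sel_H2
    connected_H1 connected_H2 in auto)

lemma wf_D: "wf_digraph D" using D by (rule D_graph_wf)

lemma wf_H1: "wf_digraph H1"
  by (simp add: wf_digraph_def sel_H1 arcs_H1)

lemma C_arcs: "C \<subseteq> arcs D" using arcs_D by blast

lemma parts_disjoint: "C \<inter> arcs H1 = {}" "C \<inter> arcs H2 = {}" "arcs H1 \<inter> arcs H2 = {}"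
proof -
  have "a \<notin> arcs H1 \<and> a \<notin> arcs H2" if "a \<in> C" for a
    using C_ends[OF that] verts_disjoint arcs_H1[of a] arcs_H2[of a] by blast
  moreover have "a \<notin> arcs H2" if "a \<in> arcs H1" for a
    using that verts_disjoint arcs_H1[of a] arcs_H2[of a] by blast
  ultimately show "C \<inter> arcs H1 = {}" "C \<inter> arcs H2 = {}" "arcs H1 \<inter> arcs H2 = {}" by blast+
qed

lemma arc_cases:
  assumes "a \<in> arcs D"
  obtains "a \<in> C" "tail D a \<in> verts H1" "head D a \<in> verts H2"
      "tail D a \<notin> verts H2" "head D a \<notin> verts H1"
    | "a \<in> arcs H1" "a \<notin> C" "tail D a \<in> verts H1" "head D a \<in> verts H1"
    | "a \<in> arcs H2" "a \<notin> C" "tail D a \<notin> verts H1" "head D a \<notin> verts H1"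
  using assms arcs_D parts_disjoint C_ends[of a] arcs_H1[of a] arcs_H2[of a] verts_disjoint by blast

abbreviation "G1 \<equiv> cut_West D C H1"

lemma G1_sel [simp]:
  "verts G1 = Inl ` verts H1 \<union> Inr ` C" "arcs G1 = arcs H1 \<union> C" "tail G1 a = Inl (tail D a)"
  "head G1 a = (if a \<in> C then Inr a else Inl (head D a))"
  by (simp_all add: cut_West_def)

lemma arcs_G1:
  assumes "v \<in> verts H1"
  shows "in_arcs G1 (Inl v) = in_arcs D v" "out_arcs G1 (Inl v) = out_arcs D v"
proof -
  have "a \<in> in_arcs G1 (Inl v) \<longleftrightarrow> a \<in> in_arcs D v" "a \<in> out_arcs G1 (Inl v) \<longleftrightarrow> a \<in> out_arcs D v" for a
  proof -
    have sub: "a \<in> arcs G1 \<Longrightarrow> a \<in> arcs D" using arcs_D by auto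
    show "a \<in> in_arcs G1 (Inl v) \<longleftrightarrow> a \<in> in_arcs D v" "a \<in> out_arcs G1 (Inl v) \<longleftrightarrow> a \<in> out_arcs D v"
      using assms sub by (cases "a \<in> arcs D"; auto elim: arc_cases split: if_splits)+
  qed
  then show "in_arcs G1 (Inl v) = in_arcs D v" "out_arcs G1 (Inl v) = out_arcs D v" by blast+
qed

lemma arcs_G1_new:
  assumes "a \<in> C"
  shows "in_arcs G1 (Inr a) = {a}" "out_arcs G1 (Inr a) = {}"
  using assms by (auto split: if_splits)

lemma side_verts_G1:
  "v \<in> verts H1 \<Longrightarrow> Inl v \<in> side_verts X G1 \<longleftrightarrow> v \<in> side_verts X D"
  "a \<in> C \<Longrightarrow> Inr a \<in> side_verts X G1 \<longleftrightarrow> X = East"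
  using arcs_G1[of v] arcs_G1_new[of a] verts_D
  by (cases X; auto simp: in_side_verts_West in_side_verts_East simp del: in_in_arcs_conv in_out_arcs_conv)+

lemma inner_verts_G1: "inner_verts G1 = Inl ` (inner_verts D \<inter> verts H1)"
  using verts_D by (auto simp: inner_verts_def side_verts_G1)

lemma tail_H1: "a \<in> arcs H1 \<union> C \<Longrightarrow> tail D a \<in> verts H1"
  using arcs_H1 C_ends by blast

lemma fin_G1: "fin_digraph G1"
proof -
  interpret fin_digraph D using D by (rule D_graph_fin)
  have "finite C" using finite_arcs finite_subset[OF C_arcs] by blast
  moreover have "finite (arcs H1)" using finite_arcs arcs_D by simp
  moreover have "finite (verts H1)" using finite_verts verts_D by simp
  ultimately show ?thesis
    by unfold_locales (use tail_H1 arcs_H1 in \<open>auto split: if_splits\<close>)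
qed

lemma ranked_G1: "ranked G1"
proof -
  interpret fin_digraph D using D by (rule D_graph_fin)
  obtain r :: "'v \<Rightarrow> nat" where r: "\<And>a. a \<in> arcs D \<Longrightarrow> r (tail D a) < r (head D a)"
    using D by (auto simp: D_graph_iff_ranked ranked_def)
  \<comment> \<open>All new vertices receive this one rank above the old ones; they only occur as
    heads.\<close>
  define m where "m = Suc (Max (r ` verts D))"
  have m: "r v < m" if "v \<in> verts D" for v using that by (simp add: m_def less_Suc_eq_le)
  have "case_sum r (\<lambda>_. m) (tail G1 a) < case_sum r (\<lambda>_. m) (head G1 a)" if "a \<in> arcs G1" for a
  proof -
    have "a \<in> arcs D" using that arcs_D by auto
    then show ?thesis using r m by simp
  qed
  then show ?thesis unfolding ranked_def by blast
qed

lemma functional_G1: "WE_functional G1"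
  unfolding WE_functional_iff
proof (intro conjI ballI)
  have sub: "side_verts X D' \<subseteq> verts D'" for X and D' :: "('v + 'e, 'e) pre_digraph"
    by (auto simp: side_verts_def)
  fix v a b
  show "a = b" if v: "v \<in> side_verts West G1" and ab: "a \<in> out_arcs G1 v" "b \<in> out_arcs G1 v"
  proof -
    obtain u where u: "v = Inl u" "u \<in> verts H1" using v sub side_verts_G1(2) by fastforce
    then have "u \<in> side_verts West D" using v side_verts_G1(1) by blast
    from West_vert_arc[OF D this] obtain c where "out_arcs D u = {c}" .
    then show ?thesis using ab u arcs_G1 by auto
  qed
  show "a = b" if v: "v \<in> side_verts East G1" and ab: "a \<in> in_arcs G1 v" "b \<in> in_arcs G1 v"
  proof -
    have "v \<in> verts G1" using v sub by blast
    then consider u where "v = Inl u" "u \<in> verts H1" | c where "v = Inr c" "c \<in> C" by auto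
    then show ?thesis
    proof cases
      case 1
      then have "u \<in> side_verts East D" using v side_verts_G1(1) by blast
      from East_vert_arc[OF D this] obtain c where "in_arcs D u = {c}" .
      then show ?thesis using ab 1 arcs_G1 by auto
    next
      case 2
      then show ?thesis using ab arcs_G1_new(1)[of c] by simp
    qed
  qed
qed

lemma connected_G1: "weakly_connected G1"
proof -
  have wf: "wf_digraph G1" using fin_G1 by (simp add: fin_digraph_def)
  have old: "(Inl u, Inl v) \<in> (adj G1)\<^sup>*" if "u \<in> verts H1" "v \<in> verts H1" for u v
  proof -
    have "(u, v) \<in> (adj H1)\<^sup>*"
      using that connected_H1 weakly_connected_iff_adj[OF wf_H1] by blast
    moreover have "(Inl x, Inl y) \<in> (adj G1)\<^sup>*" if "joins H1 a x y" for a x y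
    proof -
      have "joins G1 a (Inl x) (Inl y)"
        using that parts_disjoint(1) by (auto simp: joins_def sel_H1)
      then show ?thesis by (auto simp: adj_def)
    qed
    ultimately show ?thesis by (rule adj_rtrancl_map)
  qed
  have ex: "\<exists>u \<in> verts H1. (Inl u, v) \<in> (adj G1)\<^sup>*" if "v \<in> verts G1" for v
  proof (cases v)
    case (Inl u)
    then show ?thesis using that by auto
  next
    case (Inr a)
    then have "a \<in> C" using that by auto
    then have "joins G1 a (Inl (tail D a)) v" using Inr by (simp add: joins_def)
    then show ?thesis using C_ends[OF \<open>a \<in> C\<close>] by (auto simp: adj_def)
  qed
  have "(v, v') \<in> (adj G1)\<^sup>*" if vv: "v \<in> verts G1" "v' \<in> verts G1" for v v'
  proof -
    obtain u u' where u: "u \<in> verts H1" "(Inl u, v) \<in> (adj G1)\<^sup>*"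
      "u' \<in> verts H1" "(Inl u', v') \<in> (adj G1)\<^sup>*" using ex vv by meson
    then show ?thesis using old[OF u(1,3)] by (meson adj_rtrancl_sym rtrancl_trans)
  qed
  then show ?thesis using weakly_connected_iff_adj[OF wf] by blast
qed

lemma D_graph_G1: "D_graph G1"
proof -
  obtain a where a: "a \<in> C" using C_nonempty by blast
  \<comment> \<open>That cocycles consist of inner edges enters here: the tail of \<open>a\<close>
    is an inner vertex of \<open>D\<close>, and it stays inner after cutting.\<close>
  then have "a \<in> arcs D" "tail D a \<notin> side_verts West D"
    using C_inner by (auto simp: inner_edges_def side_edges_def)
  then have "tail D a \<in> inner_verts D" using tail_not_East[OF wf_D] by blast
  then have "inner_verts G1 \<noteq> {}" using C_ends[OF a] inner_verts_G1 by blast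
  then show ?thesis
    using fin_G1 ranked_G1 functional_G1 connected_G1 by (simp add: D_graph_iff_ranked)
qed

lemma C_East_G1: "C \<subseteq> side_edges East G1"
  by (auto simp: side_edges_def side_verts_G1)

text \<open>Cutting moves only the heads of cocycle edges, so every vertex of \<open>H1\<close>
  keeps its in-edges and out-edges and the fronts remain literally the same.\<close>

lemma run_G1:
  assumes "run D S ys M" "set ys = inner_verts D \<inter> verts H1"
  shows "run G1 S (map Inl ys) M"
  using assms by (intro run_map) (auto simp: arcs_G1 simp del: in_in_arcs_conv in_out_arcs_conv)

lemma West_edges_G1:
  assumes "set S = side_edges West D"
  shows "set S \<inter> arcs G1 = side_edges West G1"
proof -
  have "a \<in> side_edges West D \<longleftrightarrow> a \<in> side_edges West G1" if "a \<in> arcs G1" for a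
    using that tail_H1[of a] arcs_D by (auto simp: side_edges_def side_verts_G1)
  then show ?thesis using assms side_edges_subset[of West G1] by blast
qed

lemma grounded_G1:
  assumes "run D S ys M" "distinct S" "set S = side_edges West D"
    and "distinct ys" "set ys = inner_verts D \<inter> verts H1"
  shows "grounded East G1 (map (head G1) (filter (\<lambda>a. a \<in> arcs G1) M))"
    and "set M \<inter> arcs G1 = side_edges East G1"
proof -
  have ys: "distinct (map (Inl :: 'v \<Rightarrow> 'v + 'e) ys)"
    "set (map (Inl :: 'v \<Rightarrow> 'v + 'e) ys) = inner_verts G1"
    using assms(4,5) by (auto simp: inner_verts_G1 distinct_map)
  note * = D_graph_G1 run_G1[OF assms(1,5)] assms(2) West_edges_G1[OF assms(3)] ys
  show "grounded East G1 (map (head G1) (filter (\<lambda>a. a \<in> arcs G1) M))"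
    by (rule grounded_East_run[OF *])
  show "set M \<inter> arcs G1 = side_edges East G1" by (rule run_East_edges[OF *])
qed

text \<open>
  An edge \<open>e\<close> beyond the cut stays in place while the first part of the graph is swept, so the
  connected first part lies on one side of it.
\<close>

lemma same_side:
  assumes r: "run D S ys M" and S: "distinct S" "set S = side_edges West D"
    and ys: "distinct ys" "set ys = inner_verts D \<inter> verts H1"
    and M: "M = A @ e # B" and e: "e \<in> arcs H2"
    and f: "f \<in> set M" "f \<in> C \<union> arcs H1" and g: "g \<in> set M" "g \<in> C \<union> arcs H1"
  shows "f \<in> set A \<longleftrightarrow> g \<in> set A"
proof -
  \<comment> \<open>With this weight \<open>before w M h\<close> tells whether \<open>e\<close>
    precedes \<open>h\<close> in \<open>M\<close>, and edges at vertices of \<open>H1\<close> have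
    weight 0 because both ends of \<open>e\<close> lie in \<open>H2\<close>.\<close>
  define w where "w a = (if a = e then 1 else 0 :: nat)" for a
  have fresh: "out_arcs D x \<inter> set S = {}" if "x \<in> set ys" for x
    using run_fresh[of S D x] that S(2) ys(2) by blast
  have dist: "distinct M" using run_distinct_set[OF r S(1) ys(1) fresh] by simp
  have zero: "w a = 0" if "y \<in> verts H1" "a \<in> incident D y" for a y
    using that e verts_disjoint by (auto simp: w_def arcs_H2)
  have ev: "even (sum w (in_arcs D x) + sum w (out_arcs D x))" if x: "x \<in> set ys" for x
  proof -
    have "x \<in> verts H1" using x ys(2) by blast
    then have "sum w (in_arcs D x) = 0" "sum w (out_arcs D x) = 0"
      using zero[of x] by (auto intro!: sum.neutral)
    then show ?thesis by simp
  qed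
  have "\<exists>N. (\<forall>f \<in> set S. N f \<longleftrightarrow> odd (before w S f)) \<and> (\<forall>f \<in> set M. N f \<longleftrightarrow> odd (before w M f)) \<and>
      (\<forall>y \<in> set ys. (\<forall>a \<in> incident D y. w a = 0) \<longrightarrow> (\<exists>b. \<forall>a \<in> incident D y. N a = b))"
    by (rule run_parity[OF r S(1) ys(1) fresh ev])
  then obtain N where N: "\<forall>f \<in> set M. N f \<longleftrightarrow> odd (before w M f)"
    "\<forall>y \<in> set ys. (\<forall>a \<in> incident D y. w a = 0) \<longrightarrow> (\<exists>b. \<forall>a \<in> incident D y. N a = b)"
    by (elim exE conjE)
  have const: "\<exists>b. \<forall>a \<in> incident D y. N a = b" if y: "y \<in> verts H1" for y
  proof -
    have "y \<in> verts D" using y verts_D by blast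
    then show ?thesis
    proof (cases rule: verts_cases)
      case 3
      then show ?thesis using N(2) zero[OF y] y ys(2) by simp
    next
      case 1
      from side_vert_incident[OF D this] obtain a where "incident D y = {a}" .
      then show ?thesis by auto
    next
      case 2
      from side_vert_incident[OF D this] obtain a where "incident D y = {a}" .
      then show ?thesis by auto
    qed
  qed
  \<comment> \<open>The connecting semipath runs between the tails because an edge of
    \<open>C\<close> has its head outside \<open>H1\<close>.\<close>
  have tails: "tail D f \<in> verts H1" "tail D g \<in> verts H1" using tail_H1 f(2) g(2) by blast+
  then obtain us fs where p: "semipath H1 us fs" "hd us = tail D f" "last us = tail D g"
    using connected_H1 by (fastforce simp: weakly_connected_def semipaths_def)
  have arcs: "f \<in> arcs D" "g \<in> arcs D" using f(2) g(2) arcs_D by auto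
  have "N f = N g"
  proof (rule constant_along_semipath[where N = N and D = D])
    show "length us = Suc (length fs)" using p(1) by (simp add: semipath_def)
    show "\<forall>i<length fs. joins D (fs ! i) (us ! i) (us ! Suc i)"
      using p(1) arcs_D by (auto simp: semipath_def joins_def sel_H1)
    show "\<exists>b. \<forall>a \<in> incident D y. N a = b" if "y \<in> set us" for y
      using const that p(1) by (auto simp: semipath_def)
    show "f \<in> incident D (hd us)" "g \<in> incident D (last us)" using p(2,3) arcs by simp_all
  qed
  moreover have "odd (before w M h) \<longleftrightarrow> h \<notin> set A" if h: "h \<in> set M" "h \<in> C \<union> arcs H1" for h
  proof -
    have "h \<noteq> e" using h(2) e parts_disjoint by blast
    have eAB: "e \<notin> set A" "e \<notin> set B" using dist M by auto
    have "before w A h = 0" "before w B h = 0"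
      using eAB by (auto intro!: before_zero simp: w_def)
    moreover have "before w (e # B) h = 1 + before w B h"
      using \<open>h \<noteq> e\<close> by (simp add: before_def w_def)
    moreover have sum_A: "sum_list (map w A) = 0" using eAB(1) by (simp add: w_def)
    ultimately show ?thesis unfolding M before_append sum_A by simp
  qed
  ultimately show ?thesis using N(1) f g by blast
qed

end

text \<open>\<open>C\<close> will be the cocycle, \<open>P\<close> and \<open>Q\<close> the edges of
  the two parts; the last two premises come from \<open>same_side\<close> in the two orientations.
  They force \<open>C\<close> to be one block \<open>K\<close> of \<open>M\<close>, and each of the
  remaining pieces \<open>A\<close> and \<open>Z\<close> to lie entirely in \<open>P\<close> or
  entirely in \<open>Q\<close>. The four resulting combinations are the four forms of
  compatibility.\<close>

lemma compatible_lists_filter: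
  assumes dist: "distinct M" and parts: "set M \<subseteq> C \<union> P \<union> Q" "C \<inter> P = {}" "C \<inter> Q = {}" "P \<inter> Q = {}"
    and C: "set M \<inter> C \<noteq> {}"
    and P: "\<And>A e B f g. M = A @ e # B \<Longrightarrow> e \<in> P \<Longrightarrow> f \<in> set M \<Longrightarrow> f \<in> C \<union> Q \<Longrightarrow>
      g \<in> set M \<Longrightarrow> g \<in> C \<union> Q \<Longrightarrow> f \<in> set A \<longleftrightarrow> g \<in> set A"
    and Q: "\<And>A e B f g. M = A @ e # B \<Longrightarrow> e \<in> Q \<Longrightarrow> f \<in> set M \<Longrightarrow> f \<in> C \<union> P \<Longrightarrow>
      g \<in> set M \<Longrightarrow> g \<in> C \<union> P \<Longrightarrow> f \<in> set A \<longleftrightarrow> g \<in> set A"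
  shows "compatible_lists (filter (\<lambda>a. a \<in> P \<union> C) M) (filter (\<lambda>a. a \<in> Q \<union> C) M)"
proof -
  define A where "A = takeWhile (\<lambda>a. a \<notin> C) M"
  define R where "R = dropWhile (\<lambda>a. a \<notin> C) M"
  define K where "K = takeWhile (\<lambda>a. a \<in> C) R"
  define Z where "Z = dropWhile (\<lambda>a. a \<in> C) R"
  have M: "M = A @ K @ Z" by (simp add: A_def K_def Z_def R_def)
  have AC: "set A \<inter> C = {}" by (auto simp: A_def dest: set_takeWhileD)
  have KC: "set K \<subseteq> C" by (auto simp: K_def dest: set_takeWhileD)
  have "R \<noteq> []" using C by (auto simp: R_def)
  then have "hd R \<in> C" using hd_dropWhile[of "\<lambda>a. a \<notin> C" M] by (simp add: R_def)
  then obtain k where k: "k \<in> set K" "k \<in> C"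
    using \<open>R \<noteq> []\<close> by (cases R) (auto simp: K_def)
  \<comment> \<open>Let \<open>e\<close> and \<open>q\<close> be in the same piece, and
    \<open>k\<close> in the block \<open>K\<close>. Seen from \<open>e\<close>, the edges
    \<open>q\<close> and \<open>k\<close> are on the same side; seen from \<open>q\<close>, so are
    \<open>e\<close> and \<open>k\<close>. But \<open>k\<close> is on the same side of both, so
    \<open>q\<close> would precede \<open>e\<close> exactly if \<open>e\<close> precedes
    \<open>q\<close>.\<close>
  have sides: "\<not> (e \<in> P \<and> q \<in> Q)"
    if "e \<in> set Y" "q \<in> set Y" and Y: "Y = A \<or> Y = Z" for e q Y
  proof
    assume eq: "e \<in> P \<and> q \<in> Q"
    then have neq: "e \<noteq> q" using parts(4) by blast
    have mem: "e \<in> set M" "q \<in> set M" "k \<in> set M" using that k M by auto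
    obtain X1 X2 where e: "M = X1 @ e # X2" using mem(1) by (meson split_list)
    obtain Y1 Y2 where q: "M = Y1 @ q # Y2" using mem(2) by (meson split_list)
    have 1: "k \<in> set X1 \<longleftrightarrow> q \<in> set X1" using P[OF e, of k q] eq k mem by blast
    have 2: "k \<in> set Y1 \<longleftrightarrow> e \<in> set Y1" using Q[OF q, of k e] eq k mem by blast
    \<comment> \<open>Expressing both prefixes by \<open>takeWhile\<close> over the same list makes
      the positions of \<open>e\<close> and \<open>q\<close> comparable.\<close>
    have X1: "X1 = takeWhile (\<lambda>a. a \<noteq> e) M" using dist unfolding e by (subst takeWhile_append2) auto
    have Y1: "Y1 = takeWhile (\<lambda>a. a \<noteq> q) M" using dist unfolding q by (subst takeWhile_append2) auto
    have order: "q \<in> set X1 \<longleftrightarrow> e \<notin> set Y1"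
      using mem(1,2) neq unfolding X1 Y1
      by (induction M) auto
    have k_before: "k \<in> set (takeWhile (\<lambda>a. a \<noteq> x) M) \<longleftrightarrow> Y = Z" if "x \<in> set Y" for x
    proof (cases "x \<in> set A")
      case True
      then have "Y \<noteq> Z" using that dist M by auto
      moreover have "k \<notin> set (takeWhile (\<lambda>a. a \<noteq> x) M)"
        using True k AC unfolding M by (auto simp: takeWhile_append dest: set_takeWhileD)
      ultimately show ?thesis by blast
    next
      case False
      then have "Y = Z" "x \<notin> set K" using that Y dist M by auto
      then show ?thesis using False k unfolding M by (simp add: takeWhile_append)
    qed
    have "k \<in> set X1 \<longleftrightarrow> k \<in> set Y1" using k_before that(1,2) unfolding X1 Y1 by blast
    then show False using 1 2 order by blast
  qed
  \<comment> \<open>An edge of \<open>C\<close> in \<open>Z\<close> would be separated from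
    \<open>k\<close> by the first edge of \<open>Z\<close>, which lies outside \<open>C\<close> and
    hence in \<open>P\<close> or \<open>Q\<close>.\<close>
  have ZC: "set Z \<inter> C = {}"
  proof (rule ccontr)
    assume "set Z \<inter> C \<noteq> {}"
    then obtain c where c: "c \<in> set Z" "c \<in> C" by blast
    then obtain e Z' where Z': "Z = e # Z'" by (cases Z) auto
    have "e \<notin> C" using Z' by (simp add: Z_def dropWhile_eq_Cons_conv)
    then have "e \<in> P \<or> e \<in> Q" using parts(1) M Z' by auto
    moreover have M': "M = (A @ K) @ e # Z'" using M Z' by simp
    moreover have "c \<in> set M" "k \<in> set M" using c k M by auto
    ultimately have "c \<in> set (A @ K) \<longleftrightarrow> k \<in> set (A @ K)"
      using P[OF M', of c k] Q[OF M', of c k] c(2) k(2) by blast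
    then show False using dist c(1) k(1) M by auto
  qed
  have pure: "set Y \<subseteq> P \<or> set Y \<subseteq> Q" if "Y = A \<or> Y = Z" for Y
  proof -
    have "set Y \<subseteq> P \<union> Q" using that AC ZC parts(1) M by auto
    then show ?thesis using sides[of _ Y] that by blast
  qed
  have filt: "(filter (\<lambda>a. a \<in> P \<union> C) Y = Y \<and> filter (\<lambda>a. a \<in> Q \<union> C) Y = []) \<or>
      (filter (\<lambda>a. a \<in> P \<union> C) Y = [] \<and> filter (\<lambda>a. a \<in> Q \<union> C) Y = Y)" if "Y = A \<or> Y = Z" for Y
  proof -
    have "set Y \<inter> C = {}" using that AC ZC by blast
    then show ?thesis using pure[OF that] parts(4)
      by (auto simp: filter_id_conv filter_empty_conv)
  qed
  have K: "filter (\<lambda>a. a \<in> P \<union> C) K = K" "filter (\<lambda>a. a \<in> Q \<union> C) K = K"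
    using KC by (auto simp: filter_id_conv)
  have K_dist: "K \<noteq> []" "distinct (A @ K @ Z)" using k dist M by auto
  have via: "compatible_lists_via K (a @ K @ z) (a' @ K @ z')"
    if "a = A \<and> a' = [] \<or> a = [] \<and> a' = A" "z = Z \<and> z' = [] \<or> z = [] \<and> z' = Z" for a a' z z'
    using that K_dist unfolding compatible_lists_via_def
    by (elim disjE conjE; intro conjI exI[of _ A] exI[of _ Z]; simp)
  have "compatible_lists_via K (filter (\<lambda>a. a \<in> P \<union> C) M) (filter (\<lambda>a. a \<in> Q \<union> C) M)"
    unfolding M filter_append K by (rule via) (rule filt, simp)+
  then show ?thesis unfolding compatible_lists_def by blast
qed

lemma compatible_lists_map:
  assumes "compatible_lists L M" "inj_on h (set L \<union> set M)"
  shows "compatible_lists (map h L) (map h M)"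
proof -
  obtain \<Xi> \<Phi> \<Psi> where *: "\<Xi> \<noteq> []" "distinct (\<Phi> @ \<Xi> @ \<Psi>)"
    "L = \<Phi> @ \<Xi> \<and> M = \<Xi> @ \<Psi> \<or> M = \<Phi> @ \<Xi> \<and> L = \<Xi> @ \<Psi> \<or>
     L = \<Phi> @ \<Xi> @ \<Psi> \<and> M = \<Xi> \<or> M = \<Phi> @ \<Xi> @ \<Psi> \<and> L = \<Xi>"
    using assms(1) unfolding compatible_lists_def compatible_lists_via_def by blast
  have "set (\<Phi> @ \<Xi> @ \<Psi>) = set L \<union> set M" using *(3) by auto
  then have "distinct (map h (\<Phi> @ \<Xi> @ \<Psi>))" using *(2) assms(2) by (simp only: distinct_map)
  then have d: "distinct (map h \<Phi> @ map h \<Xi> @ map h \<Psi>)" by simp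
  have "map h \<Xi> \<noteq> []" using *(1) by simp
  then have "compatible_lists_via (map h \<Xi>) (map h L) (map h M)"
    unfolding compatible_lists_via_def using d *(3)
    by (intro conjI exI[of _ "map h \<Phi>"] exI[of _ "map h \<Psi>"]) auto
  then show ?thesis unfolding compatible_lists_def by blast
qed

section \<open>Combining the two cut graphs\<close>

lemma cut_East_conv_flip: "cut_East D C H = flip (cut_West (flip D) C (flip H))"
  by (auto simp: cut_East_def cut_West_def flip_def fun_eq_iff)

lemma swept_lists:
  assumes "swept D LW LE"
  shows "list_of_side West D LW" "list_of_side East D LE"
  using assms by (simp_all add: swept_def)

lemma (in cut) P_compatible_cut:
  assumes "swept D LW LE"
  shows "P_compatible (cut_West D C H1) (cut_East D C H2)"
proof -
  interpret flipped: cut "flip D" C "flip H2" "flip H1" by (rule flipped)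
  define G2 where "G2 = cut_East D C H2"
  have G2: "flip G2 = flipped.G1" by (simp add: G2_def cut_East_conv_flip)
  have G2_sel: "verts G2 = Inl ` verts H2 \<union> Inr ` C" "arcs G2 = arcs H2 \<union> C"
    "tail G2 = (\<lambda>a. if a \<in> C then Inr a else Inl (tail D a))"
    by (simp_all add: G2_def cut_East_def)
  obtain xs S T where r: "run D S xs T" "distinct xs" "set xs = inner_verts D"
    and S: "set S \<subseteq> arcs D" and T: "set T \<subseteq> arcs D"
    and LS: "map (tail D) S = LW" and LT: "map (head D) T = LE"
    using assms unfolding swept_def by blast
  have lists: "list_of_side West D (map (tail D) S)" "list_of_side East D (map (head D) T)"
    unfolding LS LT by (rule swept_lists[OF assms])+
  note S' = West_edges_of_list[OF D lists(1) S] and T' = East_edges_of_list[OF D lists(2) T]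
  let ?ys = "filter (\<lambda>x. x \<in> verts H1) xs" and ?zs = "filter (\<lambda>x. x \<notin> verts H1) xs"
  have nonempty: "in_arcs D x \<noteq> {} \<and> out_arcs D x \<noteq> {}" if "x \<in> set xs" for x
    using inner_vert_arcs[of x D] that r(3) by simp
  have forward: "in_arcs D y \<inter> out_arcs D x = {}"
    if "x \<in> set xs" "y \<in> set xs" "x \<notin> verts H1" "y \<in> verts H1" for x y
  proof -
    have "\<not> (a \<in> arcs D \<and> head D a = y \<and> tail D a = x)" for a
      using that(3,4) arc_cases[of a] by metis
    then show ?thesis by auto
  qed
  have "\<exists>M. run D S ?ys M \<and> run D M ?zs T"
    by (rule run_partition[OF r(1) nonempty forward])
  then obtain M where M1: "run D S ?ys M" and M2: "run D M ?zs T"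
    by (elim exE conjE)
  \<comment> \<open>Read backwards, the second half of the sweep is the first half of a sweep of the
    reversed graph, starting from its West edges \<open>T\<close>. The results on the western cut
    graph therefore apply to \<open>G2\<close> with the same front \<open>M\<close>.\<close>
  have M3: "run (flip D) T (rev ?zs) M" using run_flip[OF M2] .
  have ys: "distinct ?ys" "set ?ys = inner_verts D \<inter> verts H1" using r(2,3) by auto
  have "x \<notin> verts H1 \<longleftrightarrow> x \<in> verts H2" if "x \<in> inner_verts D" for x
    using subsetD[OF inner_verts_subset that] verts_D verts_disjoint by auto
  then have zs: "distinct (rev ?zs)" "set (rev ?zs) = inner_verts (flip D) \<inter> verts (flip H2)"
    using r(2,3) by auto
  have T2: "set T = side_edges West (flip D)" using T'(1) by simp
  note gW = grounded_G1[OF M1 S'(2,1) ys] and gE = flipped.grounded_G1[OF M3 T'(2) T2 zs]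
  have gE2: "grounded West G2 (map (tail G2) (filter (\<lambda>a. a \<in> arcs G2) M))"
    "set M \<inter> arcs G2 = side_edges West G2"
  proof -
    have "grounded East (flip G2) (map (head (flip G2)) (filter (\<lambda>a. a \<in> arcs (flip G2)) M))"
      "set M \<inter> arcs (flip G2) = side_edges East (flip G2)"
      unfolding G2 using gE by blast+
    then show "grounded West G2 (map (tail G2) (filter (\<lambda>a. a \<in> arcs G2) M))"
      "set M \<inter> arcs G2 = side_edges West G2" by simp_all
  qed
  have D_G2: "D_graph G2" using flipped.D_graph_G1 unfolding G2[symmetric] by (simp add: D_graph_flip)
  have fresh: "out_arcs D x \<inter> set S = {}" if "x \<in> set ?ys" for x
    using run_fresh[of S D x] that S'(1) r(3) by auto
  have distM: "distinct M" and "set M \<subseteq> arcs D"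
    using run_distinct_set[OF M1 S'(2) ys(1) fresh] S by auto
  then have setM: "set M \<subseteq> C \<union> arcs H1 \<union> arcs H2" using arcs_D by simp
  have CM: "C \<subseteq> set M" using C_East_G1 gW(2) by blast
  have "compatible_lists (filter (\<lambda>a. a \<in> arcs H1 \<union> C) M) (filter (\<lambda>a. a \<in> arcs H2 \<union> C) M)"
  proof (rule compatible_lists_filter[OF distM setM parts_disjoint])
    show "set M \<inter> C \<noteq> {}" using CM C_nonempty by blast
    fix A e B f g
    assume M: "M = A @ e # B" and f: "f \<in> set M" and g: "g \<in> set M"
    show "f \<in> set A \<longleftrightarrow> g \<in> set A" if "e \<in> arcs H1" "f \<in> C \<union> arcs H2" "g \<in> C \<union> arcs H2"
      using flipped.same_side[OF M3 T'(2) T2 zs M _ f _ g] that by simp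
    show "f \<in> set A \<longleftrightarrow> g \<in> set A" if "e \<in> arcs H2" "f \<in> C \<union> arcs H1" "g \<in> C \<union> arcs H1"
      using same_side[OF M1 S'(2,1) ys M _ f _ g] that by simp
  qed
  \<comment> \<open>\<open>h\<close> sends an edge of \<open>M\<close> to the vertex listed for it
    in a cut graph. On \<open>C\<close> the two readings agree, both giving the new vertex
    \<open>Inr a\<close>, so one map transports both edge lists. It is injective on
    \<open>M\<close>: within each cut graph because the edges of \<open>M\<close> there are side
    edges, and across the graphs because \<open>H1\<close> and \<open>H2\<close> have disjoint
    vertices.\<close>
  moreover define h :: "'e \<Rightarrow> 'v + 'e" where
    "h a = (if a \<in> arcs G1 then head G1 a else tail G2 a)" for a
  have h2: "h a = tail G2 a" if "a \<in> arcs G2" for a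
    using that parts_disjoint by (auto simp: h_def G2_sel)
  have "inj_on h (set M)"
  proof (rule inj_onI)
    fix a b assume ab: "a \<in> set M" "b \<in> set M" "h a = h b"
    have inj1: "inj_on (head G1) (set M \<inter> arcs G1)"
      unfolding gW(2) by (rule inj_on_head_East[OF D_graph_G1])
    have inj2: "inj_on (tail G2) (set M \<inter> arcs G2)"
      using inj_on_head_East[OF flipped.D_graph_G1] unfolding G2[symmetric] gE2(2) by simp
    have cross: False if "x \<in> arcs H1" "y \<in> arcs H2" "h x = h y" for x y
      using that parts_disjoint verts_disjoint arcs_H1[of x] arcs_H2[of y]
      by (auto simp: h_def G2_sel split: if_splits)
    have "a \<in> arcs G1 \<and> b \<in> arcs G1 \<or> a \<in> arcs G2 \<and> b \<in> arcs G2"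
      using ab setM cross[of a b] cross[of b a] by (auto simp: G2_sel)
    then show "a = b"
    proof
      assume "a \<in> arcs G1 \<and> b \<in> arcs G1"
      then show ?thesis using inj_onD[OF inj1, of a b] ab by (simp add: h_def del: G1_sel)
    next
      assume "a \<in> arcs G2 \<and> b \<in> arcs G2"
      then show ?thesis using inj_onD[OF inj2, of a b] ab h2 by simp
    qed
  qed
  then have "inj_on h (set (filter (\<lambda>a. a \<in> arcs H1 \<union> C) M) \<union> set (filter (\<lambda>a. a \<in> arcs H2 \<union> C) M))"
    by (rule inj_on_subset) auto
  ultimately have comp: "compatible_lists (map h (filter (\<lambda>a. a \<in> arcs G1) M)) (map h (filter (\<lambda>a. a \<in> arcs G2) M))"
    unfolding G1_sel G2_sel by (rule compatible_lists_map)
  have map1: "map h (filter (\<lambda>a. a \<in> arcs G1) M) = map (head G1) (filter (\<lambda>a. a \<in> arcs G1) M)"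
    by (rule map_cong) (simp_all add: h_def del: G1_sel)
  have map2: "map h (filter (\<lambda>a. a \<in> arcs G2) M) = map (tail G2) (filter (\<lambda>a. a \<in> arcs G2) M)"
    by (rule map_cong) (simp_all add: h2)
  have "juncture_defined G1 G2"
  proof -
    have common: "arcs G1 \<inter> arcs G2 = C" using parts_disjoint by (auto simp: G2_sel)
    have "C \<subseteq> side_edges West G2"
      using flipped.C_East_G1 unfolding G2[symmetric] by simp
    moreover have "verts G1 \<inter> verts G2 = juncture_verts G1 G2"
      using verts_disjoint unfolding juncture_verts_def common by (auto simp: G2_sel)
    ultimately show ?thesis
      using D_graph_G1 D_G2 C_nonempty C_East_G1 unfolding juncture_defined_def common
      by (auto simp: G2_sel)
  qed
  then show ?thesis
    using gW(1) gE2(1) comp unfolding map1 map2 unfolding P_compatible_def G2_def by blast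
qed

theorem theorem2p3p6:
  fixes D :: "('v, 'e) pre_digraph"
  assumes "P'_graph D"
  shows "P'''_graph D"
proof -
  obtain K LW LE where "construction K" "root K = (D, LW, LE)"
    using assms by (auto simp: P'_graph_def)
  then have s: "swept D LW LE" by (rule construction_swept)
  then have D: "D_graph D" by (simp add: swept_def)
  have "P_compatible (cut_West D C H1) (cut_East D C H2)" if "cocycle D C H1 H2" for C H1 H2
    using cut.P_compatible_cut[OF cocycle_imp_cut[OF D that] s] .
  then show ?thesis using D by (simp add: P'''_graph_def)
qed

end
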